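(* Let $h\in\{6,7\}$ and $\varepsilon\in\{+1,-1\}$, and consider the nondegenerate quadratic form over $\mathbb{Z}$ $$(V,2\theta)=\left(\mathbb{Z}^h,\left[\varepsilon\begin{pmatrix}4&4&4&\cdots&4\\0&2&2&\cdots&2\\0&0&2&\cdots&2\\\vdots&&&\ddots&\vdots\\0&0&0&\cdots&2\end{pmatrix}\right]\right),\qquad \left[\,\cdot\,\right]\in Q_+(\mathbb{Z}^h),$$ given by the upper triangular $h\times h$ matrix whose first row has all entries equal to $4$ and whose $(i,j)$ entry is $2$ for all $2\le i\le j\le h$. Then the boundary automorphism set $\operatorname{bAut}(V,2\theta)$ is non-trivial, i.e. it has more than one element.
   Context: For a finitely generated free abelian group $P$ with dual $P^*=\operatorname{Hom}(P,\mathbb{Z})$, let $\top:\operatorname{Hom}(P,P^* )\to\operatorname{Hom}(P,P^* )$ be transposition, $\top(\phi)(x)(y)=\phi(y)(x)$, and let $Q_+(P)=\operatorname{coker}(1-\top)$. A quadratic form over $\mathbb{Z}$ is a pair $(P,\psi)$ with $\psi\in Q_+(P)$; for $P=\mathbb{Z}^n$ it is represented by an integer matrix $Q$, modulo matrices of the form $M-M^T$ with $M$ an integer matrix. Its symmetrisation is $\lambda=(1+\top)\psi$, represented by $A=Q+Q^T$; the form is nondegenerate if $\det A\neq0$. An isometry $h:(P_1,\psi_1)\to(P_2,\psi_2)$ is an isomorphism $h:P_1\to P_2$ with $h^*\psi_2h=\psi_1\in Q_+(P_1)$. $\operatorname{Aut}(P,\psi)$ is the group of self-isometries. A split quadratic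 linking form is a triple $(T,b,\nu)$ with $T$ a finite abelian group, $b:T\times T\to\mathbb{Q}/\mathbb{Z}$ symmetric bilinear, and $\nu:T\to\mathbb{Q}/\mathbb{Z}$ satisfying $\nu(rx)=r^2\nu(x)$ and $\nu(x_1+x_2)-\nu(x_1)-\nu(x_2)=b(x_1,x_2)$ for all $r\in\mathbb{Z}$ and $x,x_1,x_2\in T$. An isometry of such forms is a group isomorphism preserving $b$ and $\nu$. The boundary of a nondegenerate quadratic form $(P,\psi)$ with symmetrisation $\lambda$ and adjoint $\widehat\lambda:P\to P^*$ is the split quadratic linking form $\partial(P,\psi)=(\operatorname{coker}\widehat\lambda,\partial\lambda,\partial\psi)$ with $\partial\lambda([x],[y])=\frac1s y(z)$ and $\partial\psi([x])=\frac1{s^2}\psi(z,z)$ in $\mathbb{Q}/\mathbb{Z}$, where $s\in\mathbb{Z}\setminus\{0\}$ and $z\in P$ satisfy $sx=\widehat\lambda(z)$. In matrix terms, on $\mathbb{Z}^n/A\mathbb{Z}^n$: $\partial\lambda([x],[y])=x^TA^{-1}y$ and $\partial\psi([x])=x^TA^{-1}QA^{-1}x$ modulo $\mathbb{Z}$. An isometry $g\in\operatorname{Aut}(P,\psi)$ induces $\partial g:=(g^* )^{-1}\in\operatorname{Aut}(\partial(P,\psi))$. The group $\operatorname{Aut}(P,\psi)\times\operatorname{Aut}(P,\psi)$ acts on the set $\operatorname{Aut}(\partial(P,\psi))$ by $(g_1,g_2)\cdot f=\partial g_1\circ f\circ\partial g_2^{-1}$, and the boundary automorphism set is the orbit set $\operatorname{bAut}(P,\psi)=\operatorname{Aut}(\partial(P,\psi))/\bigl(\operatorname{Aut}(P,\psi)\times\operatorname{Aut}(P,\psi)\bigr)$.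 *)

theory Defs
  imports "Jordan_Normal_Form.Determinant" "HOL-Algebra.Bij" "HOL-Algebra.Group_Action"
begin

section \<open>Quadratic forms over the integers\<close>

text \<open>
  The free abelian group \<open>P\<close> is \<open>\<int>\<^sup>n\<close>, i.e. \<^term>\<open>carrier_vec n\<close>, and \<open>P\<^sup>*\<close> is identified with
  \<open>\<int>\<^sup>n\<close> through the dual basis, so that \<open>y(z) = y \<bullet> z\<close>.  A homomorphism \<open>P \<rightarrow> P\<^sup>*\<close> is an integer
  matrix.  Elements of \<open>Q\<^sub>+(P)\<close> are cosets, that is, sets of matrices.  Functions
  on a quotient are given as \<^term>\<open>the_elem\<close> of the set of values
  at all representatives, which is a singleton whenever the function is well defined.
\<close>

definition Q_plus :: "nat \<Rightarrow> int mat set monoid" where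
  "Q_plus n = add_monoid (ring_mat TYPE(int) n ()) Mod {M - M\<^sup>T | M. M \<in> carrier_mat n n}"

definition form_class :: "nat \<Rightarrow> int mat \<Rightarrow> int mat set" where
  "form_class n Q =
     {M - M\<^sup>T | M. M \<in> carrier_mat n n} #>\<^bsub>add_monoid (ring_mat TYPE(int) n ())\<^esub> Q"

definition symmetrisation :: "int mat set \<Rightarrow> int mat" where
  "symmetrisation \<psi> = the_elem ((\<lambda>Q. Q + Q\<^sup>T) ` \<psi>)"

definition form_value :: "int mat set \<Rightarrow> int vec \<Rightarrow> int" where
  "form_value \<psi> z = the_elem ((\<lambda>Q. z \<bullet> (Q *\<^sub>v z)) ` \<psi>)"

definition nondegenerate :: "int mat set \<Rightarrow> bool" where
  "nondegenerate \<psi> \<longleftrightarrow> det (symmetrisation \<psi>) \<noteq> 0"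

definition pullback :: "nat \<Rightarrow> int mat \<Rightarrow> int mat set \<Rightarrow> int mat set" where
  "pullback n H \<psi> = the_elem ((\<lambda>Q. form_class n (H\<^sup>T * Q * H)) ` \<psi>)"

definition form_isometry :: "nat \<Rightarrow> int mat set \<Rightarrow> int mat set \<Rightarrow> int mat \<Rightarrow> bool" where
  "form_isometry n \<psi>1 \<psi>2 H \<longleftrightarrow> H \<in> Units (ring_mat TYPE(int) n ()) \<and> pullback n H \<psi>2 = \<psi>1"

definition Aut_form :: "nat \<Rightarrow> int mat set \<Rightarrow> int mat monoid" where
  "Aut_form n \<psi> = (units_of (ring_mat TYPE(int) n ()))\<lparr>carrier := {G. form_isometry n \<psi> \<psi> G}\<rparr>"


section \<open>Split quadratic linking forms\<close>

definition rat_group :: "rat monoid" where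
  "rat_group = \<lparr>carrier = UNIV, mult = (+), one = 0\<rparr>"

definition QZ :: "rat set monoid" where
  "QZ = rat_group Mod \<int>"

definition QZ_class :: "rat \<Rightarrow> rat set" where
  "QZ_class q = \<int> #>\<^bsub>rat_group\<^esub> q"

record 'a linking_form = "'a monoid" +
  lf_bilin :: "'a \<Rightarrow> 'a \<Rightarrow> rat set"
  lf_quad :: "'a \<Rightarrow> rat set"

locale split_quadratic_linking_form = comm_group T for T :: "('a, 'b) linking_form_scheme" (structure) +
  assumes finite_carrier: "finite (carrier T)"
    and bilin_closed: "\<lbrakk>x \<in> carrier T; y \<in> carrier T\<rbrakk> \<Longrightarrow> lf_bilin T x y \<in> carrier QZ"
    and bilin_sym: "\<lbrakk>x \<in> carrier T; y \<in> carrier T\<rbrakk> \<Longrightarrow> lf_bilin T x y = lf_bilin T y x"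
    and bilin_add: "\<lbrakk>x \<in> carrier T; y \<in> carrier T; z \<in> carrier T\<rbrakk> \<Longrightarrow>
          lf_bilin T (x \<otimes> y) z = lf_bilin T x z \<otimes>\<^bsub>QZ\<^esub> lf_bilin T y z"
    and quad_closed: "x \<in> carrier T \<Longrightarrow> lf_quad T x \<in> carrier QZ"
    and quad_scale: "x \<in> carrier T \<Longrightarrow> lf_quad T (x [^] (r::int)) = lf_quad T x [^]\<^bsub>QZ\<^esub> (r^2)"
    and quad_add: "\<lbrakk>x \<in> carrier T; y \<in> carrier T\<rbrakk> \<Longrightarrow>
          lf_quad T (x \<otimes> y) \<otimes>\<^bsub>QZ\<^esub> inv\<^bsub>QZ\<^esub> (lf_quad T x) \<otimes>\<^bsub>QZ\<^esub> inv\<^bsub>QZ\<^esub> (lf_quad T y) = lf_bilin T x y"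

definition linking_isometry ::
    "('a, 'c) linking_form_scheme \<Rightarrow> ('b, 'd) linking_form_scheme \<Rightarrow> ('a \<Rightarrow> 'b) \<Rightarrow> bool" where
  "linking_isometry T1 T2 f \<longleftrightarrow> f \<in> iso T1 T2 \<and>
     (\<forall>x\<in>carrier T1. \<forall>y\<in>carrier T1. lf_bilin T2 (f x) (f y) = lf_bilin T1 x y) \<and>
     (\<forall>x\<in>carrier T1. lf_quad T2 (f x) = lf_quad T1 x)"

text \<open>Extensionality makes equality of automorphisms equality on the carrier.\<close>

definition Aut_linking :: "('a, 'b) linking_form_scheme \<Rightarrow> ('a \<Rightarrow> 'a) monoid" where
  "Aut_linking T =
     (BijGroup (carrier T))\<lparr>carrier := {f \<in> extensional (carrier T). linking_isometry T T f}\<rparr>"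


section \<open>Boundary and boundary automorphism set\<close>

definition coker :: "nat \<Rightarrow> int mat \<Rightarrow> int vec set monoid" where
  "coker n A = monoid_vec TYPE(int) n Mod ((\<lambda>v. A *\<^sub>v v) ` carrier_vec n)"

definition boundary_bilin :: "nat \<Rightarrow> int mat set \<Rightarrow> int vec set \<Rightarrow> int vec set \<Rightarrow> rat set" where
  "boundary_bilin n \<psi> X Y = the_elem {QZ_class (of_int (y \<bullet> z) / of_int s) | x y s z.
     x \<in> X \<and> y \<in> Y \<and> s \<noteq> 0 \<and> z \<in> carrier_vec n \<and> s \<cdot>\<^sub>v x = symmetrisation \<psi> *\<^sub>v z}"

definition boundary_quad :: "nat \<Rightarrow> int mat set \<Rightarrow> int vec set \<Rightarrow> rat set" where
  "boundary_quad n \<psi> X = the_elem {QZ_class (of_int (form_value \<psi> z) / of_int (s^2)) | x s z.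
     x \<in> X \<and> s \<noteq> 0 \<and> z \<in> carrier_vec n \<and> s \<cdot>\<^sub>v x = symmetrisation \<psi> *\<^sub>v z}"

definition boundary :: "nat \<Rightarrow> int mat set \<Rightarrow> int vec set linking_form" where
  "boundary n \<psi> = (let T = coker n (symmetrisation \<psi>) in
     \<lparr>carrier = carrier T, mult = mult T, one = one T,
      lf_bilin = boundary_bilin n \<psi>, lf_quad = boundary_quad n \<psi>\<rparr>)"

text \<open>
  \<open>g\<^sup>* : P\<^sup>* \<rightarrow> P\<^sup>*\<close> is the transpose of \<open>g\<close>; its inverse preserves the image of the adjoint of the
  symmetrisation, so it maps cosets to cosets.
\<close>

definition boundary_aut :: "nat \<Rightarrow> int mat set \<Rightarrow> int mat \<Rightarrow> int vec set \<Rightarrow> int vec set" where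
  "boundary_aut n \<psi> G = (\<lambda>X\<in>carrier (boundary n \<psi>).
     (\<lambda>x. (inv\<^bsub>ring_mat TYPE(int) n ()\<^esub> (G\<^sup>T)) *\<^sub>v x) ` X)"

definition boundary_action ::
    "nat \<Rightarrow> int mat set \<Rightarrow> int mat \<times> int mat \<Rightarrow>
       (int vec set \<Rightarrow> int vec set) \<Rightarrow> (int vec set \<Rightarrow> int vec set)" where
  "boundary_action n \<psi> = (\<lambda>(G1, G2) f.
     boundary_aut n \<psi> G1 \<otimes>\<^bsub>Aut_linking (boundary n \<psi>)\<^esub> f
       \<otimes>\<^bsub>Aut_linking (boundary n \<psi>)\<^esub> inv\<^bsub>Aut_linking (boundary n \<psi>)\<^esub> (boundary_aut n \<psi> G2))"

definition bAut :: "nat \<Rightarrow> int mat set \<Rightarrow> (int vec set \<Rightarrow> int vec set) set set" where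
  "bAut n \<psi> = orbits (Aut_form n \<psi> \<times>\<times> Aut_form n \<psi>)
     (carrier (Aut_linking (boundary n \<psi>))) (boundary_action n \<psi>)"


section \<open>The forms \<open>(V, 2\<theta>)\<close>\<close>

definition two_theta_mat :: "nat \<Rightarrow> int \<Rightarrow> int mat" where
  "two_theta_mat h \<epsilon> =
     \<epsilon> \<cdot>\<^sub>m mat h h (\<lambda>(i, j). if j < i then 0 else if i = 0 then 4 else 2)"

definition two_theta :: "nat \<Rightarrow> int \<Rightarrow> int mat set" where
  "two_theta h \<epsilon> = form_class h (two_theta_mat h \<epsilon>)"


section \<open>Well-definedness\<close>

lemma form_class_eq:
  "Q \<in> carrier_mat n n \<Longrightarrow> form_class n Q = {M - M\<^sup>T + Q | M. M \<in> carrier_mat n n}"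
  by (auto simp: form_class_def r_coset_def ring_mat_simps)

lemma form_class_in_Q_plus: "Q \<in> carrier_mat n n \<Longrightarrow> form_class n Q \<in> carrier (Q_plus n)"
  by (auto simp: Q_plus_def FactGroup_def RCOSETS_def form_class_def ring_mat_simps)

lemma Q_plus_cases:
  assumes "\<psi> \<in> carrier (Q_plus n)"
  obtains Q where "Q \<in> carrier_mat n n" "\<psi> = form_class n Q"
  using assms by (auto simp: Q_plus_def FactGroup_def RCOSETS_def form_class_def ring_mat_simps)

lemma the_elem_image_eq:
  assumes "x \<in> S" "\<And>y. y \<in> S \<Longrightarrow> f y = c"
  shows "the_elem (f ` S) = c"
proof -
  have "f ` S = {c}" using assms by auto
  then show ?thesis by simp
qed

lemma form_class_self: "Q \<in> carrier_mat n n \<Longrightarrow> Q \<in> form_class n Q"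
  by (auto simp: form_class_eq intro!: exI[of _ "0\<^sub>m n n"])

lemma symmetrisation_form_class:
  assumes "Q \<in> carrier_mat n n"
  shows "symmetrisation (form_class n Q) = Q + Q\<^sup>T"
  unfolding symmetrisation_def
proof (rule the_elem_image_eq[OF form_class_self[OF assms]])
  fix R assume "R \<in> form_class n Q"
  then obtain M where M: "M \<in> carrier_mat n n" "R = M - M\<^sup>T + Q"
    using assms by (auto simp: form_class_eq)
  show "R + R\<^sup>T = Q + Q\<^sup>T"
    by (rule eq_matI) (use M assms in auto)
qed

lemma form_value_form_class:
  assumes Q: "Q \<in> carrier_mat n n" and z: "z \<in> carrier_vec n"
  shows "form_value (form_class n Q) z = z \<bullet> (Q *\<^sub>v z)"
  unfolding form_value_def
proof (rule the_elem_image_eq[OF form_class_self[OF Q]])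
  fix R assume "R \<in> form_class n Q"
  then obtain M where M: "M \<in> carrier_mat n n" "R = M - M\<^sup>T + Q"
    using Q by (auto simp: form_class_eq)
  have "R *\<^sub>v z = (M - M\<^sup>T) *\<^sub>v z + Q *\<^sub>v z"
    unfolding M(2) by (rule add_mult_distrib_mat_vec[where nr=n and nc=n]) (use M Q z in auto)
  moreover have "(M - M\<^sup>T) *\<^sub>v z = M *\<^sub>v z - M\<^sup>T *\<^sub>v z"
    by (rule minus_mult_distrib_mat_vec[where nr=n and nc=n]) (use M z in auto)
  ultimately have 1: "R *\<^sub>v z = (M *\<^sub>v z - M\<^sup>T *\<^sub>v z) + Q *\<^sub>v z" by simp
  have 2: "z \<bullet> (M\<^sup>T *\<^sub>v z) = z \<bullet> (M *\<^sub>v z)"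
    using transpose_vec_mult_scalar[OF M(1) z z] M(1) z
      comm_scalar_prod[of "M *\<^sub>v z" n z] comm_scalar_prod[of z n "M\<^sup>T *\<^sub>v z"] by simp
  have "z \<bullet> (R *\<^sub>v z) = z \<bullet> (M *\<^sub>v z - M\<^sup>T *\<^sub>v z) + z \<bullet> (Q *\<^sub>v z)"
    unfolding 1 by (rule scalar_prod_add_distrib[where n=n]) (use M Q z in auto)
  moreover have "z \<bullet> (M *\<^sub>v z - M\<^sup>T *\<^sub>v z) = z \<bullet> (M *\<^sub>v z) - z \<bullet> (M\<^sup>T *\<^sub>v z)"
    by (rule scalar_prod_minus_distrib[where n=n]) (use M Q z in auto)
  ultimately show "z \<bullet> (R *\<^sub>v z) = z \<bullet> (Q *\<^sub>v z)" using 2 by simp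
qed

lemma two_theta_in_Q_plus: "two_theta h \<epsilon> \<in> carrier (Q_plus h)"
  by (simp add: two_theta_def form_class_in_Q_plus two_theta_mat_def)

lemma two_theta_mat_carrier [simp]: "two_theta_mat h \<epsilon> \<in> carrier_mat h h"
  by (simp add: two_theta_mat_def)

lemma nondegenerate_two_theta:
  assumes h: "h \<in> {6, 7}" and e: "\<epsilon> \<in> {1, -1}"
  shows "nondegenerate (two_theta h \<epsilon>)"
proof -
  define A where "A = two_theta_mat h \<epsilon> + (two_theta_mat h \<epsilon>)\<^sup>T"
  define C where "C = mat h h (\<lambda>(i, j). if i = 0 \<and> j = 0 then int h
     else if i = 0 \<or> j = 0 then -2 else if i = j then 4 else 0)"
  have cA: "A \<in> carrier_mat h h" "C \<in> carrier_mat h h"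
    by (auto simp: A_def C_def two_theta_mat_def)
  define a where "a i k = (2 * \<epsilon> * (if i = 0 \<and> k = 0 then 4 else if i = 0 \<or> k = 0 then 2
     else 1 + of_bool (i = k)) :: int)" for i k :: nat
  define c where "c k j = (if k = 0 \<and> j = 0 then int h
     else if k = 0 \<or> j = 0 then -2 else 4 * of_bool (k = j))" for k j :: nat
  have A: "A $$ (i, k) = a i k" if "i < h" "k < h" for i k
    using that by (auto simp: A_def two_theta_mat_def a_def)
  have C: "C $$ (i, k) = c i k" if "i < h" "k < h" for i k
    using that by (auto simp: C_def c_def)
  obtain m where m: "h = Suc m" using h by auto
  have ob: "(\<Sum>k<m. of_bool (i = k) :: int) = 1" if "i < m" for i
    using sum.delta[of "{..<m}" i "\<lambda>_. 1::int"] that by (simp add: of_bool_def)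
  have row: "(\<Sum>k<m. a i (Suc k)) = (if i = 0 then 4 * \<epsilon> * int m else 2 * \<epsilon> * (int m + 1))"
    if "i < h" for i
    using that by (cases i) (simp_all add: a_def m ob sum.distrib sum_distrib_left[symmetric])
  have pick: "(\<Sum>k<m. a i (Suc k) * c (Suc k) (Suc j)) = 4 * a i (Suc j)" if "j < m" for i j
  proof -
    have "(\<Sum>k<m. a i (Suc k) * c (Suc k) (Suc j)) = (\<Sum>k<m. if k = j then 4 * a i (Suc k) else 0)"
      by (rule sum.cong) (auto simp: c_def)
    then show ?thesis using that by simp
  qed
  have ac: "(\<Sum>k<h. a i k * c k j) = 8 * \<epsilon> * of_bool (i = j)" if "i < h" "j < h" for i j
  proof (cases j)
    case 0
    have "(\<Sum>k<h. a i k * c k j) = a i 0 * c 0 0 + (\<Sum>k<m. a i (Suc k) * c (Suc k) 0)"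
      by (simp only: m sum.lessThan_Suc_shift 0)
    also have "\<dots> = a i 0 * int h + (\<Sum>k<m. a i (Suc k)) * - 2"
      by (simp only: sum_distrib_right) (simp add: c_def)
    finally have E: "(\<Sum>k<h. a i k * c k j) = a i 0 * int h + (\<Sum>k<m. a i (Suc k)) * - 2" .
    show ?thesis unfolding E row[OF that(1)] using 0 by (simp add: a_def m algebra_simps)
  next
    case (Suc j')
    then have j': "j' < m" using that m by simp
    have E: "(\<Sum>k<h. a i k * c k j) = a i 0 * - 2 + 4 * a i (Suc j')"
      by (simp only: m sum.lessThan_Suc_shift Suc pick[OF j']) (simp add: c_def)
    show ?thesis unfolding E using Suc by (simp add: a_def)
  qed
  have "A * C = (8 * \<epsilon>) \<cdot>\<^sub>m 1\<^sub>m h"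
  proof (rule eq_matI)
    fix i j assume "i < dim_row ((8 * \<epsilon>) \<cdot>\<^sub>m 1\<^sub>m h)" "j < dim_col ((8 * \<epsilon>) \<cdot>\<^sub>m 1\<^sub>m h)"
    then have ij: "i < h" "j < h" by auto
    then have "(A * C) $$ (i, j) = (\<Sum>k<h. a i k * c k j)"
      using cA A C by (simp add: scalar_prod_def lessThan_atLeast0)
    then show "(A * C) $$ (i, j) = ((8 * \<epsilon>) \<cdot>\<^sub>m 1\<^sub>m h) $$ (i, j)"
      using ij by (simp add: ac)
  qed (use cA in auto)
  then have "det A * det C = (8 * \<epsilon>) ^ h"
    using det_mult[OF cA] by (simp add: det_smult)
  moreover have "(8 * \<epsilon>) ^ h \<noteq> 0" using e by auto
  ultimately have "det A \<noteq> 0" by auto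
  then show ?thesis
    by (simp add: nondegenerate_def two_theta_def symmetrisation_form_class A_def)
qed

lemma rat_comm_group: "comm_group rat_group"
  by (rule comm_groupI) (auto simp: rat_group_def intro: exI[of _ "- x" for x])

lemma rat_normal: "\<int> \<lhd> rat_group"
proof -
  interpret comm_group rat_group by (rule rat_comm_group)
  have inv: "inv\<^bsub>rat_group\<^esub> x = - x" for x
    by (rule inv_equality) (auto simp: rat_group_def)
  have "subgroup \<int> rat_group"
    by (rule subgroupI) (use inv in \<open>auto simp: rat_group_def\<close>)
  then show ?thesis by (rule subgroup_imp_normal)
qed

lemma QZ_class_eq: "QZ_class q = {of_int k + q | k. True}"
  by (auto simp: QZ_class_def r_coset_def rat_group_def Ints_def)

lemma QZ_class_eq_iff: "QZ_class p = QZ_class q \<longleftrightarrow> p - q \<in> \<int>"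
proof
  assume "QZ_class p = QZ_class q"
  moreover have "p \<in> QZ_class p" by (auto simp: QZ_class_eq intro: exI[of _ 0])
  ultimately show "p - q \<in> \<int>" by (auto simp: QZ_class_eq)
next
  assume "p - q \<in> \<int>"
  then obtain k where "p = of_int k + q" by (auto elim!: Ints_cases simp: algebra_simps)
  then show "QZ_class p = QZ_class q"
    by (auto simp: QZ_class_eq algebra_simps) (metis add.commute add.left_commute add_diff_cancel_left' diff_add_cancel of_int_add of_int_diff)+
qed

lemma QZ_comm_group: "comm_group QZ"
  unfolding QZ_def using rat_comm_group rat_normal
  by (simp add: comm_group.abelian_FactGroup normal_imp_subgroup)

lemma QZ_class_carrier: "QZ_class q \<in> carrier QZ"
  by (auto simp: QZ_def carrier_FactGroup QZ_class_def rat_group_def)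

lemma QZ_class_add: "QZ_class p \<otimes>\<^bsub>QZ\<^esub> QZ_class q = QZ_class (p + q)"
  using normal.rcos_sum[OF rat_normal, of p q]
  by (simp add: QZ_def QZ_class_def rat_group_def)

lemma QZ_class_inv: "inv\<^bsub>QZ\<^esub> QZ_class p = QZ_class (- p)"
proof -
  interpret Z: comm_group QZ by (rule QZ_comm_group)
  have "QZ_class (-p) \<otimes>\<^bsub>QZ\<^esub> QZ_class p = \<one>\<^bsub>QZ\<^esub>"
    unfolding QZ_class_add by (auto simp: QZ_def QZ_class_def r_coset_def rat_group_def)
  then show ?thesis by (rule Z.inv_equality) (simp_all add: QZ_class_carrier)
qed

lemma rat_group_nat_pow: "x [^]\<^bsub>rat_group\<^esub> (r::nat) = of_nat r * x"
proof -
  interpret comm_group rat_group by (rule rat_comm_group)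
  show ?thesis by (induction r) (auto simp: rat_group_def algebra_simps)
qed

lemma rat_group_pow: "x [^]\<^bsub>rat_group\<^esub> (r::int) = of_int r * x"
proof -
  interpret comm_group rat_group by (rule rat_comm_group)
  have inv: "inv\<^bsub>rat_group\<^esub> x = - x" for x
    by (rule inv_equality) (auto simp: rat_group_def)
  have c: "x \<in> carrier rat_group" by (simp add: rat_group_def)
  show ?thesis by (cases r rule: int_cases2)
     (simp_all add: int_pow_int int_pow_neg[OF c] rat_group_nat_pow inv)
qed

lemma QZ_class_pow: "QZ_class q [^]\<^bsub>QZ\<^esub> (r::int) = QZ_class (of_int r * q)"
  unfolding QZ_def QZ_class_def
  using normal.FactGroup_int_pow[OF rat_normal, of q r] by (simp add: rat_group_pow) (simp add: rat_group_def)

lemma mult_mat_smult_vec: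
  fixes M :: "'a :: comm_ring mat"
  assumes "M \<in> carrier_mat m n" "v \<in> carrier_vec n"
  shows "M *\<^sub>v (k \<cdot>\<^sub>v v) = k \<cdot>\<^sub>v (M *\<^sub>v v)"
  using assms by (intro eq_vecI) (auto simp: scalar_prod_def sum_distrib_left mult.left_commute)

lemma boundary_is_split_quadratic_linking_form:
  assumes psi: "\<psi> \<in> carrier (Q_plus n)" and nd: "nondegenerate \<psi>"
  shows "split_quadratic_linking_form (boundary n \<psi>)"
proof -
  obtain Q where Q: "Q \<in> carrier_mat n n" and psiQ: "\<psi> = form_class n Q"
    using psi by (rule Q_plus_cases)
  define A where "A = Q + Q\<^sup>T"
  have A: "A \<in> carrier_mat n n" using Q by (simp add: A_def)
  have QT: "Q\<^sup>T \<in> carrier_mat n n" using Q by simp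
  have AT: "A\<^sup>T = A" by (rule eq_matI) (use Q in \<open>auto simp: A_def\<close>)
  have sym: "symmetrisation \<psi> = A" using Q by (simp add: psiQ symmetrisation_form_class A_def)
  have detA: "det A \<noteq> 0" using nd by (simp add: nondegenerate_def sym)
  have fv: "form_value \<psi> z = z \<bullet> (Q *\<^sub>v z)" if "z \<in> carrier_vec n" for z
    using Q that by (simp add: psiQ form_value_form_class)
  define B where "B = adj_mat A"
  have B: "B \<in> carrier_mat n n" "A * B = det A \<cdot>\<^sub>m 1\<^sub>m n" "B * A = det A \<cdot>\<^sub>m 1\<^sub>m n"
    using adj_mat[OF A] by (auto simp: B_def)
  have smv: "(k \<cdot>\<^sub>m 1\<^sub>m n) *\<^sub>v v = k \<cdot>\<^sub>v v" if "v \<in> carrier_vec n" for k :: int and v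
    using that by (intro eq_vecI) (auto simp: smult_scalar_prod_distrib[where n=n])
  have AB: "A *\<^sub>v (B *\<^sub>v v) = det A \<cdot>\<^sub>v v" if "v \<in> carrier_vec n" for v
    using assoc_mult_mat_vec[OF A B(1) that] B(2) smv[OF that] by simp
  have BA: "B *\<^sub>v (A *\<^sub>v v) = det A \<cdot>\<^sub>v v" if "v \<in> carrier_vec n" for v
    using assoc_mult_mat_vec[OF B(1) A that] B(3) smv[OF that] by simp
  have Ac: "A *\<^sub>v v \<in> carrier_vec n" if "v \<in> carrier_vec n" for v using A that by simp
  have inj: "u = v" if "A *\<^sub>v u = A *\<^sub>v v" and c: "u \<in> carrier_vec n" "v \<in> carrier_vec n" for u v
  proof -
    have "det A \<cdot>\<^sub>v u = det A \<cdot>\<^sub>v v" using BA[OF c(1)] BA[OF c(2)] that by simp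
    then have "det A * u $ i = det A * v $ i" if "i < n" for i
      using that c by (metis carrier_vecD index_smult_vec(1))
    then show ?thesis using c detA by (intro eq_vecI) auto
  qed
  have Asym: "(A *\<^sub>v v) \<bullet> z = v \<bullet> (A *\<^sub>v z)" if "v \<in> carrier_vec n" "z \<in> carrier_vec n" for v z
    using transpose_vec_mult_scalar[of A n n z v] A that AT by simp
  have Aadd: "A *\<^sub>v (u + v) = A *\<^sub>v u + A *\<^sub>v v" if "u \<in> carrier_vec n" "v \<in> carrier_vec n" for u v
    using A that by (simp add: mult_add_distrib_mat_vec)
  have Asm: "A *\<^sub>v (k \<cdot>\<^sub>v v) = k \<cdot>\<^sub>v (A *\<^sub>v v)" if "v \<in> carrier_vec n" for k v
    by (rule mult_mat_smult_vec[OF A that])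

  define V where "V = monoid_vec TYPE(int) n"
  define I where "I = (\<lambda>v. A *\<^sub>v v) ` carrier_vec n"
  have V: "carrier V = carrier_vec n" "mult V = (+)" "one V = 0\<^sub>v n"
    by (simp_all add: V_def monoid_vec_def)
  interpret V: comm_group V
  proof (rule comm_groupI)
    fix x assume "x \<in> carrier V"
    then show "\<exists>y\<in>carrier V. y \<otimes>\<^bsub>V\<^esub> x = \<one>\<^bsub>V\<^esub>"
      by (intro bexI[of _ "- x"]) (auto simp: V)
  qed (auto simp: V comm_add_vec[where n=n])
  have Vinv: "inv\<^bsub>V\<^esub> x = - x" if "x \<in> carrier V" for x
    by (rule V.inv_equality) (use that in \<open>auto simp: V\<close>)
  have "subgroup I V"
  proof (rule V.subgroupI)
    show "I \<subseteq> carrier V" using Ac by (auto simp: I_def V)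
    show "I \<noteq> {}" unfolding I_def by (metis empty_iff image_is_empty zero_carrier_vec)
    fix a b assume "a \<in> I" "b \<in> I"
    then obtain u v where uv: "u \<in> carrier_vec n" "v \<in> carrier_vec n" "a = A *\<^sub>v u" "b = A *\<^sub>v v"
      by (auto simp: I_def)
    then show "a \<otimes>\<^bsub>V\<^esub> b \<in> I" using Aadd by (auto simp: I_def V intro!: image_eqI[of _ _ "u+v"])
    have "inv\<^bsub>V\<^esub> a = A *\<^sub>v ((-1) \<cdot>\<^sub>v u)"
      using uv Vinv[of a] Ac Asm by (auto simp: V)
    then show "inv\<^bsub>V\<^esub> a \<in> I" using uv by (auto simp: I_def)
  qed
  then have IV: "subgroup I V" .
  then have nI: "I \<lhd> V" by (rule V.subgroup_imp_normal)
  define cl where "cl x = I #>\<^bsub>V\<^esub> x" for x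
  define T where "T = boundary n \<psi>"
  have Tc: "carrier T = cl ` carrier_vec n"
    by (simp add: T_def boundary_def Let_def sym coker_def carrier_FactGroup V_def[symmetric] I_def[symmetric] V cl_def)
  have TM: "monoid.truncate T = V Mod I"
    by (simp add: T_def boundary_def Let_def sym coker_def V_def[symmetric] I_def[symmetric] monoid.truncate_def)
  have Tm: "mult T = mult (V Mod I)" "one T = one (V Mod I)" "carrier T = carrier (V Mod I)"
    by (simp_all add: T_def boundary_def Let_def sym coker_def V_def[symmetric] I_def[symmetric])
  interpret F: comm_group "V Mod I" using IV by (rule V.abelian_FactGroup)
  have cl_eq: "cl x = {A *\<^sub>v w + x | w. w \<in> carrier_vec n}" for x
    by (auto simp: cl_def r_coset_def I_def V)
  have cl_self: "x \<in> cl x" if "x \<in> carrier_vec n" for x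
    unfolding cl_eq using that A by (auto intro!: exI[of _ "0\<^sub>v n"])
  have cl_add: "cl x \<otimes>\<^bsub>T\<^esub> cl y = cl (x + y)" if "x \<in> carrier_vec n" "y \<in> carrier_vec n" for x y
    using normal.rcos_sum[OF nI, of x y] that by (simp add: Tm cl_def V)

  have sol: "\<exists>z\<in>carrier_vec n. det A \<cdot>\<^sub>v x = A *\<^sub>v z" if "x \<in> carrier_vec n" for x
    using AB[OF that] B(1) that by (metis mult_mat_vec_carrier)
  have key: "s \<cdot>\<^sub>v z' = s' \<cdot>\<^sub>v (z + s \<cdot>\<^sub>v w)"
    if c: "x \<in> carrier_vec n" "z \<in> carrier_vec n" "z' \<in> carrier_vec n" "w \<in> carrier_vec n"
      and e: "s \<cdot>\<^sub>v x = A *\<^sub>v z" "s' \<cdot>\<^sub>v (A *\<^sub>v w + x) = A *\<^sub>v z'" for x z z' w s s'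
  proof (rule inj)
    have "A *\<^sub>v (s \<cdot>\<^sub>v z') = s \<cdot>\<^sub>v (s' \<cdot>\<^sub>v (A *\<^sub>v w + x))" using Asm c e by simp
    also have "\<dots> = s' \<cdot>\<^sub>v (s \<cdot>\<^sub>v x + s \<cdot>\<^sub>v (A *\<^sub>v w))"
      using c A by (intro eq_vecI) (auto simp: algebra_simps)
    also have "\<dots> = A *\<^sub>v (s' \<cdot>\<^sub>v (z + s \<cdot>\<^sub>v w))" using e c by (simp add: Asm Aadd)
    finally show "A *\<^sub>v (s \<cdot>\<^sub>v z') = A *\<^sub>v (s' \<cdot>\<^sub>v (z + s \<cdot>\<^sub>v w))" .
  qed (use c in auto)

  have bil: "boundary_bilin n \<psi> (cl x) (cl y) = QZ_class (of_int (y \<bullet> z) / of_int s)"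
    if c: "x \<in> carrier_vec n" "y \<in> carrier_vec n" "z \<in> carrier_vec n"
      and s: "s \<noteq> 0" "s \<cdot>\<^sub>v x = A *\<^sub>v z" for x y z s
  proof -
    have "QZ_class (of_int (y' \<bullet> z') / of_int s') = QZ_class (of_int (y \<bullet> z) / of_int s)"
      if x': "x' \<in> cl x" and y': "y' \<in> cl y" and s': "s' \<noteq> 0" and z': "z' \<in> carrier_vec n"
        and e: "s' \<cdot>\<^sub>v x' = A *\<^sub>v z'" for x' y' s' z'
    proof -
      obtain w v where w: "w \<in> carrier_vec n" "x' = A *\<^sub>v w + x" and v: "v \<in> carrier_vec n" "y' = A *\<^sub>v v + y"
        using x' y' by (auto simp: cl_eq)
      have y'c: "y' \<in> carrier_vec n" using v c A by simp
      have k: "s \<cdot>\<^sub>v z' = s' \<cdot>\<^sub>v (z + s \<cdot>\<^sub>v w)"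
        by (rule key[of x]) (use c w z' s e in auto)
      have "s * (y' \<bullet> z') = y' \<bullet> (s \<cdot>\<^sub>v z')" using y'c z' by simp
      also have "\<dots> = s' * (y' \<bullet> z + s * (y' \<bullet> w))"
        unfolding k using y'c c w by (simp add: scalar_prod_add_distrib[where n=n])
      also have "y' \<bullet> z = (A *\<^sub>v v) \<bullet> z + y \<bullet> z"
        unfolding v using v c Ac by (simp add: add_scalar_prod_distrib[where n=n])
      also have "(A *\<^sub>v v) \<bullet> z = s * (v \<bullet> x)"
        using Asym[OF v(1) c(3)] s(2)[symmetric] v c by simp
      finally have m: "s * (y' \<bullet> z') = s' * (y \<bullet> z) + s * s' * (v \<bullet> x + y' \<bullet> w)"
        by (simp add: algebra_simps)
      have "rat_of_int (y' \<bullet> z') / of_int s' - of_int (y \<bullet> z) / of_int s = of_int (v \<bullet> x + y' \<bullet> w)"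
        using arg_cong[OF m, of rat_of_int] s s' by (simp add: field_simps)
      then show ?thesis by (simp add: QZ_class_eq_iff del: of_int_add)
    qed
    then have "{QZ_class (of_int (y \<bullet> z) / of_int s) | x' y s z.
       x' \<in> cl x \<and> y \<in> cl y' \<and> s \<noteq> 0 \<and> z \<in> carrier_vec n \<and> s \<cdot>\<^sub>v x' = A *\<^sub>v z} = {QZ_class (of_int (y \<bullet> z) / of_int s)}"
      if "y' = y" for y'
      using that cl_self[OF c(1)] cl_self[OF c(2)] c s by blast
    then show ?thesis by (simp add: boundary_bilin_def sym)
  qed

  define q where "q z = z \<bullet> (Q *\<^sub>v z)" for z
  have q_add: "q (u + v) = q u + q v + u \<bullet> (A *\<^sub>v v)" if c: "u \<in> carrier_vec n" "v \<in> carrier_vec n" for u v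
  proof -
    have "v \<bullet> (Q *\<^sub>v u) = u \<bullet> (Q\<^sup>T *\<^sub>v v)"
      using transpose_vec_mult_scalar[OF Q c(1) c(2)] c Q
       comm_scalar_prod[of "Q\<^sup>T *\<^sub>v v" n u] by simp
    moreover have "A *\<^sub>v v = Q *\<^sub>v v + Q\<^sup>T *\<^sub>v v"
      unfolding A_def by (rule add_mult_distrib_mat_vec[OF Q QT c(2)])
    ultimately show ?thesis using c Q
      by (simp add: q_def mult_add_distrib_mat_vec[OF Q] scalar_prod_add_distrib[where n=n]
         add_scalar_prod_distrib[where n=n])
  qed
  have q_sm: "q (k \<cdot>\<^sub>v u) = k^2 * q u" if c: "u \<in> carrier_vec n" for k u
    using c Q by (simp add: q_def mult_mat_smult_vec[OF Q] power2_eq_square)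

  have quad: "boundary_quad n \<psi> (cl x) = QZ_class (of_int (q z) / of_int (s^2))"
    if c: "x \<in> carrier_vec n" "z \<in> carrier_vec n"
      and s: "s \<noteq> 0" "s \<cdot>\<^sub>v x = A *\<^sub>v z" for x z s
  proof -
    have "QZ_class (of_int (form_value \<psi> z') / of_int (s'^2)) = QZ_class (of_int (q z) / of_int (s^2))"
      if x': "x' \<in> cl x" and s': "s' \<noteq> 0" and z': "z' \<in> carrier_vec n"
        and e: "s' \<cdot>\<^sub>v x' = A *\<^sub>v z'" for x' s' z'
    proof -
      obtain w where w: "w \<in> carrier_vec n" "x' = A *\<^sub>v w + x"
        using x' by (auto simp: cl_eq)
      have k: "s \<cdot>\<^sub>v z' = s' \<cdot>\<^sub>v (z + s \<cdot>\<^sub>v w)"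
        by (rule key[of x]) (use c w z' s e in auto)
      have "z \<bullet> (A *\<^sub>v w) = w \<bullet> (A *\<^sub>v z)"
        using Asym[OF c(2) w(1)] comm_scalar_prod[of "A *\<^sub>v z" n w] Ac c w by simp
      also have "\<dots> = s * (w \<bullet> x)" using s(2)[symmetric] c w by simp
      finally have l: "z \<bullet> (A *\<^sub>v w) = s * (w \<bullet> x)" .
      have "s^2 * q z' = q (s \<cdot>\<^sub>v z')" using q_sm z' by simp
      also have "\<dots> = s'^2 * (q z + s^2 * q w + s^2 * (w \<bullet> x))"
        unfolding k using c w l Ac by (simp add: q_sm q_add Asm power2_eq_square)
      finally have m: "s^2 * q z' = s'^2 * q z + s^2 * s'^2 * (q w + w \<bullet> x)"
        by (simp add: algebra_simps)
      have "rat_of_int (q z') / of_int (s'^2) - of_int (q z) / of_int (s^2) = of_int (q w + w \<bullet> x)"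
        using arg_cong[OF m, of rat_of_int] s s' by (simp add: field_simps)
      then show ?thesis by (simp add: QZ_class_eq_iff fv[OF z'] q_def del: of_int_add)
    qed
    then have "{QZ_class (of_int (form_value \<psi> z) / of_int (s^2)) | x' s z.
       x' \<in> cl x \<and> s \<noteq> 0 \<and> z \<in> carrier_vec n \<and> s \<cdot>\<^sub>v x' = A *\<^sub>v z} = {QZ_class (of_int (q z) / of_int (s^2))}"
      using cl_self[OF c(1)] c s by blast
    then show ?thesis by (simp add: boundary_quad_def sym)
  qed

  define d where "d = det A"
  define g where "g x = B *\<^sub>v x" for x
  have gc: "g x \<in> carrier_vec n" if "x \<in> carrier_vec n" for x using that B by (simp add: g_def)
  have gA: "d \<cdot>\<^sub>v x = A *\<^sub>v g x" if "x \<in> carrier_vec n" for x using AB[OF that] by (simp add: g_def d_def)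
  have g_add: "g (x + y) = g x + g y" if "x \<in> carrier_vec n" "y \<in> carrier_vec n" for x y
    using mult_add_distrib_mat_vec[OF B(1) that] by (simp add: g_def)
  have g_sm: "g (k \<cdot>\<^sub>v x) = k \<cdot>\<^sub>v g x" if "x \<in> carrier_vec n" for x k
    using mult_mat_smult_vec[OF B(1) that] by (simp add: g_def)
  have d0: "d \<noteq> 0" using detA by (simp add: d_def)
  have bilT: "lf_bilin T (cl x) (cl y) = QZ_class (of_int (y \<bullet> g x) / of_int d)"
    if "x \<in> carrier_vec n" "y \<in> carrier_vec n" for x y
    using bil[OF that gc[OF that(1)] d0 gA[OF that(1)]] by (simp add: T_def boundary_def Let_def)
  have quadT: "lf_quad T (cl x) = QZ_class (of_int (q (g x)) / of_int (d^2))"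
    if "x \<in> carrier_vec n" for x
    using quad[OF that gc[OF that(1)] d0 gA[OF that(1)]] by (simp add: T_def boundary_def Let_def)
  have gsym: "y \<bullet> g x = x \<bullet> g y" if c: "x \<in> carrier_vec n" "y \<in> carrier_vec n" for x y
  proof -
    have "d * (y \<bullet> g x) = (A *\<^sub>v g y) \<bullet> g x" using gA[OF c(2), symmetric] c gc by simp
    also have "\<dots> = (A *\<^sub>v g x) \<bullet> g y"
      using Asym[OF gc[OF c(2)] gc[OF c(1)]] comm_scalar_prod[of "A *\<^sub>v g x" n "g y"] Ac gc c by simp
    also have "\<dots> = d * (x \<bullet> g y)" using gA[OF c(1), symmetric] c gc by simp
    finally show ?thesis using d0 by simp
  qed

  have cl_pow: "cl x [^]\<^bsub>T\<^esub> (r::int) = cl (r \<cdot>\<^sub>v x)" if x: "x \<in> carrier_vec n" for x r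
  proof -
    have 1: "x [^]\<^bsub>V\<^esub> (k::nat) = int k \<cdot>\<^sub>v x" for k
      by (induction k) (use x in \<open>auto simp: V add_smult_distrib_vec[symmetric] algebra_simps intro!: eq_vecI\<close>)
    have xV: "x \<in> carrier V" using x by (simp add: V)
    have 2: "x [^]\<^bsub>V\<^esub> r = r \<cdot>\<^sub>v x"
    proof (cases r rule: int_cases2)
      case (nonneg k)
      then show ?thesis by (simp add: int_pow_int 1)
    next
      case (nonpos k)
      have "x [^]\<^bsub>V\<^esub> r = - (int k \<cdot>\<^sub>v x)"
        unfolding nonpos V.int_pow_neg[OF xV] using x by (simp add: int_pow_int 1 Vinv V)
      also have "\<dots> = r \<cdot>\<^sub>v x" using nonpos x by (intro eq_vecI) auto
      finally show ?thesis .
    qed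
    have "cl x [^]\<^bsub>T\<^esub> r = cl x [^]\<^bsub>V Mod I\<^esub> r"
      by (simp add: int_pow_def nat_pow_def Tm m_inv_def Let_def)
    then show ?thesis
      using normal.FactGroup_int_pow[OF nI, of x r] x 2 by (simp add: cl_def V)
  qed

  have fin: "finite (carrier T)"
  proof -
    let ?S = "vec n ` ({..<n} \<rightarrow>\<^sub>E {0..<\<bar>d\<bar>})"
    have "carrier T \<subseteq> cl ` ?S"
    proof
      fix X assume "X \<in> carrier T"
      then obtain x where x: "x \<in> carrier_vec n" "X = cl x" by (auto simp: Tc)
      define r where "r = vec n (\<lambda>i. x $ i mod \<bar>d\<bar>)"
      define p where "p = vec n (\<lambda>i. sgn d * (x $ i div \<bar>d\<bar>))"
      have p: "p \<in> carrier_vec n" and r: "r \<in> carrier_vec n" by (auto simp: p_def r_def)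
      have "x = d \<cdot>\<^sub>v p + r"
      proof (rule eq_vecI)
        fix i assume "i < dim_vec (d \<cdot>\<^sub>v p + r)"
        then have i: "i < n" using r by auto
        have "x $ i = d * (sgn d * (x $ i div \<bar>d\<bar>)) + x $ i mod \<bar>d\<bar>"
          by (metis abs_sgn mult.assoc mult_div_mod_eq)
        then show "x $ i = (d \<cdot>\<^sub>v p + r) $ i" using i
          by (simp add: p_def r_def)
      qed (use x r in auto)
      then have "x = A *\<^sub>v g p + r" using gA[OF p] by simp
      then have "x \<in> cl r" using gc[OF p] by (auto simp: cl_eq)
      then have "cl x = cl r"
        unfolding cl_def using V.repr_independence[of x I r] IV r by (simp add: V)
      moreover have "r = vec n (\<lambda>i\<in>{..<n}. x $ i mod \<bar>d\<bar>)"
        by (rule eq_vecI) (auto simp: r_def)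
      moreover have "(\<lambda>i\<in>{..<n}. x $ i mod \<bar>d\<bar>) \<in> {..<n} \<rightarrow>\<^sub>E {0..<\<bar>d\<bar>}" using d0 by auto
      ultimately show "X \<in> cl ` ?S" using x by blast
    qed
    moreover have "finite (cl ` ?S)" by (intro finite_imageI finite_PiE) auto
    ultimately show ?thesis by (rule finite_subset)
  qed

  have Tgrp: "comm_group T"
    by (rule comm_groupI)
       (use F.m_assoc F.m_comm F.l_inv_ex in \<open>simp_all add: Tm del: mult_FactGroup one_FactGroup\<close>)
  note QZs = QZ_class_add QZ_class_inv QZ_class_carrier QZ_class_pow
  show ?thesis unfolding T_def[symmetric]
  proof (rule split_quadratic_linking_form.intro[OF Tgrp], unfold_locales)
    show "finite (carrier T)" by (rule fin)
    fix X assume "X \<in> carrier T"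
    then obtain x where x: "x \<in> carrier_vec n" "X = cl x" by (auto simp: Tc)
    show "lf_quad T X \<in> carrier QZ" using x by (simp add: quadT QZs)
    show "lf_quad T (X [^]\<^bsub>T\<^esub> r) = lf_quad T X [^]\<^bsub>QZ\<^esub> (r\<^sup>2)" for r :: int
      using x by (simp add: cl_pow quadT QZs g_sm q_sm gc)
    fix Y assume "Y \<in> carrier T"
    then obtain y where y: "y \<in> carrier_vec n" "Y = cl y" by (auto simp: Tc)
    show "lf_bilin T X Y \<in> carrier QZ" using x y by (simp add: bilT QZs)
    show "lf_bilin T X Y = lf_bilin T Y X" using x y gsym by (simp add: bilT)
    have "g x \<bullet> (A *\<^sub>v g y) = d * (y \<bullet> g x)"
      using gA[OF y(1), symmetric] x y gc comm_scalar_prod[of y n "g x"] by simp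
    then have "q (g (x + y)) = q (g x) + q (g y) + d * (y \<bullet> g x)"
      using x y gc by (simp add: g_add q_add)
    then have "rat_of_int (q (g (x + y))) / of_int (d^2) - of_int (q (g x)) / of_int (d^2)
        - of_int (q (g y)) / of_int (d^2) = of_int (y \<bullet> g x) / of_int d"
      using d0 by (simp add: field_simps power2_eq_square)
    then show "lf_quad T (X \<otimes>\<^bsub>T\<^esub> Y) \<otimes>\<^bsub>QZ\<^esub> inv\<^bsub>QZ\<^esub> lf_quad T X \<otimes>\<^bsub>QZ\<^esub> inv\<^bsub>QZ\<^esub> lf_quad T Y = lf_bilin T X Y"
      using x y by (simp add: cl_add quadT bilT QZs)
    fix Z assume "Z \<in> carrier T"
    then obtain z where z: "z \<in> carrier_vec n" "Z = cl z" by (auto simp: Tc)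
    show "lf_bilin T (X \<otimes>\<^bsub>T\<^esub> Y) Z = lf_bilin T X Z \<otimes>\<^bsub>QZ\<^esub> lf_bilin T Y Z"
      using x y z gc by (simp add: cl_add bilT QZs g_add scalar_prod_add_distrib[where n=n] add_divide_distrib)
  qed
qed

end

theory Submission
  imports Defs
begin

text \<open>
  Up to sign, \<open>\<theta>\<close> is the root lattice \<open>D\<^sub>h\<close> in the basis \<open>2 e\<^sub>0\<close>, \<open>e\<^sub>0 + e\<^sub>i\<close> (\<open>0 < i < h\<close>).  So the
  boundary is \<open>D\<^sub>h\<^sup>* / 2 D\<^sub>h\<close> with \<open>\<nu>(p) = \<epsilon> \<bar>p\<bar>\<^sup>2 / 4\<close>, and an automorphism induced by an isometry
  preserves the set of norms occurring in each class, because it lifts to an isometry of \<open>D\<^sub>h\<^sup>*\<close>.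
  Let \<open>u = e\<^sub>0 + \<dots> + e\<^sub>5\<close>, of norm 6.  The map \<open>p \<mapsto> p + (p \<bullet> u) u\<close>, modelled on the 2-adically
  integral reflection in \<open>u\<close>, is an automorphism of the boundary.  It sends the class of \<open>e\<^sub>1\<close>,
  which contains a vector of norm 1, to the class of \<open>e\<^sub>1 + u\<close>, whose members have five odd
  coordinates and hence norm at least 5.  So it is not in the orbit of the identity.
\<close>

section \<open>The automorphism group of a linking form\<close>

lemma group_Aut_linking:
  assumes "group T"
  shows "group (Aut_linking T)"
proof -
  interpret T: group T by fact
  interpret B: group "BijGroup (carrier T)" by (rule group_BijGroup)
  let ?H = "{f \<in> extensional (carrier T). linking_isometry T T f}"
  \<comment> \<open>Splitting off \<open>auto T\<close>, already a subgroup of the bijections,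
    leaves only the two invariance conditions to be checked for inverses and composites.\<close>
  have H: "f \<in> ?H \<longleftrightarrow> f \<in> auto T \<and>
     (\<forall>x\<in>carrier T. \<forall>y\<in>carrier T. lf_bilin T (f x) (f y) = lf_bilin T x y) \<and>
     (\<forall>x\<in>carrier T. lf_quad T (f x) = lf_quad T x)" for f
    by (auto simp: linking_isometry_def auto_def iso_def Bij_def)
  interpret S: subgroup "auto T" "BijGroup (carrier T)" by (rule T.subgroup_auto)
  have Hc: "f x \<in> carrier T" if "f \<in> auto T" "x \<in> carrier T" for f x
    using that by (auto simp: auto_def hom_def)
  have "subgroup ?H (BijGroup (carrier T))"
  proof (rule B.subgroupI)
    show "?H \<subseteq> carrier (BijGroup (carrier T))"
      using S.subset H by blast
    have "(\<lambda>x\<in>carrier T. x) \<in> ?H"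
      unfolding H using T.id_in_auto by simp
    then show "?H \<noteq> {}" by blast
  next
    fix f assume f: "f \<in> ?H"
    then have fa: "f \<in> auto T" unfolding H by blast
    then have fB: "f \<in> Bij (carrier T)" by (simp add: auto_def)
    have inv: "inv\<^bsub>BijGroup (carrier T)\<^esub> f = (\<lambda>x\<in>carrier T. inv_into (carrier T) f x)"
      by (rule inv_BijGroup[OF fB])
    have g: "inv_into (carrier T) f x \<in> carrier T" "f (inv_into (carrier T) f x) = x"
      if "x \<in> carrier T" for x
      using fB that by (auto simp: Bij_def bij_betw_def inv_into_into f_inv_into_f)
    show "inv\<^bsub>BijGroup (carrier T)\<^esub> f \<in> ?H"
      unfolding H
    proof (intro conjI ballI)
      show "inv\<^bsub>BijGroup (carrier T)\<^esub> f \<in> auto T" using fa by (rule S.m_inv_closed)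
      fix x assume x: "x \<in> carrier T"
      show "lf_quad T ((inv\<^bsub>BijGroup (carrier T)\<^esub> f) x) = lf_quad T x"
        using f g[OF x] x unfolding H inv by (metis restrict_apply')
      fix y assume y: "y \<in> carrier T"
      show "lf_bilin T ((inv\<^bsub>BijGroup (carrier T)\<^esub> f) x) ((inv\<^bsub>BijGroup (carrier T)\<^esub> f) y) = lf_bilin T x y"
        using f g[OF x] g[OF y] x y unfolding H inv by (metis restrict_apply')
    qed
  next
    fix f g assume fg: "f \<in> ?H" "g \<in> ?H"
    then have fa: "f \<in> auto T" "g \<in> auto T" unfolding H by blast+
    then have "f \<otimes>\<^bsub>BijGroup (carrier T)\<^esub> g = compose (carrier T) f g"
      by (simp add: BijGroup_def auto_def)
    then show "f \<otimes>\<^bsub>BijGroup (carrier T)\<^esub> g \<in> ?H"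
      using S.m_closed[OF fa] Hc[OF fa(2)] fg unfolding H by (simp add: compose_def)
  qed
  then show ?thesis
    unfolding Aut_linking_def by (rule B.subgroup_imp_group)
qed

lemma Aut_linking_mult:
  assumes "f \<in> carrier (Aut_linking T)" "g \<in> carrier (Aut_linking T)"
  shows "f \<otimes>\<^bsub>Aut_linking T\<^esub> g = compose (carrier T) f g"
  using assms by (simp add: Aut_linking_def BijGroup_def Bij_def linking_isometry_def iso_def)

lemma Aut_linking_one: "\<one>\<^bsub>Aut_linking T\<^esub> = (\<lambda>x\<in>carrier T. x)"
  by (simp add: Aut_linking_def BijGroup_def)

section \<open>Congruence on classes of quadratic forms\<close>

lemma form_class_add_alternating:
  assumes "N \<in> carrier_mat n n" "S \<in> carrier_mat n n"
  shows "form_class n (N - N\<^sup>T + S) = form_class n S"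
proof -
  have c: "N - N\<^sup>T + S \<in> carrier_mat n n" using assms by auto
  show ?thesis
    unfolding form_class_eq[OF c] form_class_eq[OF assms(2)]
  proof (intro Set.set_eqI iffI; clarsimp)
    fix M :: "int mat" assume M: "M \<in> carrier_mat n n"
    show "\<exists>M'. M - M\<^sup>T + (N - N\<^sup>T + S) = M' - M'\<^sup>T + S \<and> M' \<in> carrier_mat n n"
      by (rule exI[of _ "M + N"], intro conjI eq_matI) (use M assms in auto)
    show "\<exists>M'. M - M\<^sup>T + S = M' - M'\<^sup>T + (N - N\<^sup>T + S) \<and> M' \<in> carrier_mat n n"
      by (rule exI[of _ "M - N"], intro conjI eq_matI) (use M assms in auto)
  qed
qed

text \<open>Congruence by \<open>G\<close> turns \<open>M - M\<^sup>T\<close> into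
  \<open>N - N\<^sup>T\<close> with \<open>N = G\<^sup>T * M * G\<close>. Hence all representatives
  give the same class, and the \<open>the_elem\<close> in \<open>pullback\<close> may be evaluated
  at \<open>Q\<close>.\<close>

lemma pullback_form_class:
  assumes G: "G \<in> carrier_mat n n" and Q: "Q \<in> carrier_mat n n"
  shows "pullback n G (form_class n Q) = form_class n (G\<^sup>T * Q * G)"
  unfolding pullback_def
proof (rule the_elem_image_eq[OF form_class_self[OF Q]])
  fix R assume "R \<in> form_class n Q"
  then obtain M where M: "M \<in> carrier_mat n n" "R = M - M\<^sup>T + Q"
    using Q by (auto simp: form_class_eq)
  have GT: "G\<^sup>T \<in> carrier_mat n n" and MT: "M\<^sup>T \<in> carrier_mat n n" using G M by auto
  have tr: "(G\<^sup>T * M * G)\<^sup>T = G\<^sup>T * M\<^sup>T * G"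
    using G M GT MT by (simp add: transpose_mult[where nc=n and nr=n and n=n] assoc_mult_mat[where n\<^sub>1=n and n\<^sub>2=n and n\<^sub>3=n and n\<^sub>4=n])
  have "G\<^sup>T * R * G = G\<^sup>T * M * G - G\<^sup>T * M\<^sup>T * G + G\<^sup>T * Q * G"
  proof -
    have "G\<^sup>T * R = G\<^sup>T * M - G\<^sup>T * M\<^sup>T + G\<^sup>T * Q"
      unfolding M(2) using GT M MT Q
      by (simp add: minus_carrier_mat mult_add_distrib_mat[where nr=n and n=n and nc=n] mult_minus_distrib_mat[where nr=n and n=n and nc=n])
    then show ?thesis
      using G GT M MT Q
      by (simp add: minus_carrier_mat add_mult_distrib_mat[where nr=n and n=n and nc=n] minus_mult_distrib_mat[where nr=n and n=n and nc=n])
  qed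
  then show "form_class n (G\<^sup>T * R * G) = form_class n (G\<^sup>T * Q * G)"
    unfolding tr[symmetric] using G M GT Q by (simp add: form_class_add_alternating)
qed

text \<open>Symmetrisation kills \<open>M - M\<^sup>T\<close>, so the equality of classes that
  defines an isometry becomes an exact matrix identity.\<close>

lemma form_isometry_symmetrisation:
  assumes G: "G \<in> carrier_mat n n" and Q: "Q \<in> carrier_mat n n"
    and iso: "form_isometry n (form_class n Q) (form_class n Q) G"
  shows "G\<^sup>T * (Q + Q\<^sup>T) * G = Q + Q\<^sup>T"
proof -
  have GT: "G\<^sup>T \<in> carrier_mat n n" and QT: "Q\<^sup>T \<in> carrier_mat n n" using G Q by auto
  have S: "G\<^sup>T * Q * G \<in> carrier_mat n n" using G Q by simp
  have tr: "(G\<^sup>T * Q * G)\<^sup>T = G\<^sup>T * Q\<^sup>T * G"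
    using G Q GT QT by (simp add: transpose_mult[where nc=n and nr=n and n=n] assoc_mult_mat[where n\<^sub>1=n and n\<^sub>2=n and n\<^sub>3=n and n\<^sub>4=n])
  have "form_class n (G\<^sup>T * Q * G) = form_class n Q"
    using iso by (simp add: form_isometry_def pullback_form_class[OF G Q])
  from arg_cong[OF this, of symmetrisation]
  have "G\<^sup>T * Q * G + G\<^sup>T * Q\<^sup>T * G = Q + Q\<^sup>T"
    by (simp add: symmetrisation_form_class[OF S] symmetrisation_form_class[OF Q] tr)
  then show ?thesis
    using G Q GT QT by (simp add: add_mult_distrib_mat[where nr=n and n=n and nc=n] mult_add_distrib_mat[where nr=n and n=n and nc=n])
qed

section \<open>The boundary of a form whose symmetrisation has a scaled integral inverse\<close>

lemma add_diff_cancel_vec: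
  fixes a b :: "'a :: ab_group_add vec"
  assumes "a \<in> carrier_vec n" "b \<in> carrier_vec n"
  shows "a + b - b = a"
  using assms by (intro eq_vecI) auto

text \<open>\<open>C\<close> is an integral multiple \<open>d A\<^sup>-\<^sup>1\<close> of the inverse of the symmetrisation, so that
  \<open>\<partial>\<psi>([x])\<close> becomes \<open>x \<bullet> C x / (2 d)\<close>.\<close>

locale scaled_inverse =
  fixes n :: nat and Q C :: "int mat" and d :: int
  assumes Q: "Q \<in> carrier_mat n n" and C: "C \<in> carrier_mat n n"
    and AC: "(Q + Q\<^sup>T) * C = d \<cdot>\<^sub>m 1\<^sub>m n" and CA: "C * (Q + Q\<^sup>T) = d \<cdot>\<^sub>m 1\<^sub>m n"
    and d0: "d \<noteq> 0"
begin

definition A :: "int mat" where "A = Q + Q\<^sup>T"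

definition T :: "int vec set linking_form" where "T = boundary n (form_class n Q)"

definition I :: "int vec set" where "I = (\<lambda>w. A *\<^sub>v w) ` carrier_vec n"

definition cl :: "int vec \<Rightarrow> int vec set" where "cl x = {A *\<^sub>v w + x | w. w \<in> carrier_vec n}"

definition norm_form :: "int vec \<Rightarrow> int" where "norm_form x = x \<bullet> (C *\<^sub>v x)"

lemma A: "A \<in> carrier_mat n n" and AT: "A\<^sup>T = A"
  using Q by (auto simp: A_def intro: comm_add_mat)

lemma sym: "symmetrisation (form_class n Q) = A"
  using Q by (simp add: symmetrisation_form_class A_def)

lemma closed [simp]:
  "v \<in> carrier_vec n \<Longrightarrow> A *\<^sub>v v \<in> carrier_vec n" "v \<in> carrier_vec n \<Longrightarrow> C *\<^sub>v v \<in> carrier_vec n"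
  using A C by simp_all

lemma scalar_mat_mult_vec: "v \<in> carrier_vec n \<Longrightarrow> ((k::int) \<cdot>\<^sub>m 1\<^sub>m n) *\<^sub>v v = k \<cdot>\<^sub>v v"
  by (intro eq_vecI) (auto simp: smult_scalar_prod_distrib[where n=n])

lemma A_C: "v \<in> carrier_vec n \<Longrightarrow> A *\<^sub>v (C *\<^sub>v v) = d \<cdot>\<^sub>v v"
  and C_A: "v \<in> carrier_vec n \<Longrightarrow> C *\<^sub>v (A *\<^sub>v v) = d \<cdot>\<^sub>v v"
  using assoc_mult_mat_vec[OF A C] assoc_mult_mat_vec[OF C A] AC CA
  by (simp_all add: A_def[symmetric] scalar_mat_mult_vec)

lemma A_self_adjoint:
  "v \<in> carrier_vec n \<Longrightarrow> z \<in> carrier_vec n \<Longrightarrow> (A *\<^sub>v v) \<bullet> z = v \<bullet> (A *\<^sub>v z)"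
  using transpose_vec_mult_scalar[of A n n z v] A AT by simp

lemma A_add: "u \<in> carrier_vec n \<Longrightarrow> v \<in> carrier_vec n \<Longrightarrow> A *\<^sub>v (u + v) = A *\<^sub>v u + A *\<^sub>v v"
  and C_add: "u \<in> carrier_vec n \<Longrightarrow> v \<in> carrier_vec n \<Longrightarrow> C *\<^sub>v (u + v) = C *\<^sub>v u + C *\<^sub>v v"
  using A C by (simp_all add: mult_add_distrib_mat_vec)

lemma A_smult: "v \<in> carrier_vec n \<Longrightarrow> A *\<^sub>v (k \<cdot>\<^sub>v v) = k \<cdot>\<^sub>v (A *\<^sub>v v)"
  and C_smult: "v \<in> carrier_vec n \<Longrightarrow> C *\<^sub>v (k \<cdot>\<^sub>v v) = k \<cdot>\<^sub>v (C *\<^sub>v v)"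
  by (simp_all add: mult_mat_smult_vec[OF A] mult_mat_smult_vec[OF C])

lemma smult_cancel:
  assumes "k \<noteq> (0::int)" "k \<cdot>\<^sub>v u = k \<cdot>\<^sub>v v" and c: "u \<in> carrier_vec n" "v \<in> carrier_vec n"
  shows "u = v"
proof (rule eq_vecI)
  fix i assume "i < dim_vec v"
  then have "(k \<cdot>\<^sub>v u) $ i = k * u $ i" "(k \<cdot>\<^sub>v v) $ i = k * v $ i" using c by auto
  then show "u $ i = v $ i" using assms(1,2) by simp
qed (use c in auto)

lemma A_cancel:
  assumes "A *\<^sub>v u = A *\<^sub>v v" "u \<in> carrier_vec n" "v \<in> carrier_vec n"
  shows "u = v"
  using assms C_A smult_cancel[OF d0] by metis

lemma form_twice:
  assumes z: "z \<in> carrier_vec n"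
  shows "z \<bullet> (A *\<^sub>v z) = 2 * (z \<bullet> (Q *\<^sub>v z))"
proof -
  have "z \<bullet> (Q\<^sup>T *\<^sub>v z) = z \<bullet> (Q *\<^sub>v z)"
    using transpose_vec_mult_scalar[OF Q z z] Q z comm_scalar_prod[of "Q *\<^sub>v z" n z]
      comm_scalar_prod[of z n "Q\<^sup>T *\<^sub>v z"] by simp
  moreover have "A *\<^sub>v z = Q *\<^sub>v z + Q\<^sup>T *\<^sub>v z"
    unfolding A_def using Q z by (intro add_mult_distrib_mat_vec) auto
  ultimately show ?thesis
    using Q z by (simp add: scalar_prod_add_distrib[where n=n])
qed

text \<open>Nondegeneracy comes from \<open>det A * det C = d ^ n\<close> and
  \<open>d \<noteq> 0\<close>. The result supplies the finiteness and the polarisation identity that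
  \<open>class_map_in_Aut\<close> relies on.\<close>

lemma split_quadratic: "split_quadratic_linking_form T"
proof -
  have "det A * det C = d ^ n"
    using det_mult[OF A C] AC by (simp add: A_def[symmetric] det_smult)
  then have "det A \<noteq> 0" using d0 by auto
  then show ?thesis
    unfolding T_def using Q
    by (intro boundary_is_split_quadratic_linking_form form_class_in_Q_plus)
      (auto simp: nondegenerate_def sym)
qed

sublocale T: split_quadratic_linking_form T
  by (rule split_quadratic)

lemma cl_iff: "x \<in> carrier_vec n \<Longrightarrow> y \<in> carrier_vec n \<Longrightarrow> cl x = cl y \<longleftrightarrow> x - y \<in> I"
proof
  assume c: "x \<in> carrier_vec n" "y \<in> carrier_vec n" and e: "cl x = cl y"
  have "x \<in> cl x" unfolding cl_def using A c by (auto intro!: exI[of _ "0\<^sub>v n"])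
  then obtain w where w: "w \<in> carrier_vec n" "x = A *\<^sub>v w + y" using e by (auto simp: cl_def)
  have "x - y = A *\<^sub>v w" unfolding w(2) using w(1) c by (simp add: add_diff_cancel_vec[where n=n])
  then show "x - y \<in> I" using w by (auto simp: I_def)
next
  assume c: "x \<in> carrier_vec n" "y \<in> carrier_vec n" and "x - y \<in> I"
  then obtain w where w: "w \<in> carrier_vec n" "x - y = A *\<^sub>v w" by (auto simp: I_def)
  have x: "x = y + A *\<^sub>v w" unfolding w(2)[symmetric] using c by (intro eq_vecI) auto
  show "cl x = cl y"
  proof (intro Set.set_eqI iffI)
    fix z assume "z \<in> cl x"
    then obtain v where v: "v \<in> carrier_vec n" "z = A *\<^sub>v v + x" by (auto simp: cl_def)
    have "z = A *\<^sub>v (v + w) + y"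
      unfolding v(2) x using v w c A by (simp add: A_add) (intro eq_vecI, auto simp del: index_mult_mat_vec)
    then show "z \<in> cl y" using v w by (auto simp: cl_def)
  next
    fix z assume "z \<in> cl y"
    then obtain v where v: "v \<in> carrier_vec n" "z = A *\<^sub>v v + y" by (auto simp: cl_def)
    have "A *\<^sub>v (v + (-1) \<cdot>\<^sub>v w) = A *\<^sub>v v + (-1) \<cdot>\<^sub>v (A *\<^sub>v w)"
      using v w by (simp add: A_add A_smult)
    then have "z = A *\<^sub>v (v + (-1) \<cdot>\<^sub>v w) + x"
      unfolding v(2) x using v w c A by (intro eq_vecI) (auto simp del: index_mult_mat_vec)
    then show "z \<in> cl x" using v w by (auto simp: cl_def intro!: exI[of _ "v + (-1) \<cdot>\<^sub>v w"])
  qed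
qed

lemma cl_self: "x \<in> carrier_vec n \<Longrightarrow> x \<in> cl x"
  unfolding cl_def using A by (auto intro!: exI[of _ "0\<^sub>v n"])

lemma mem_cl:
  assumes "x \<in> carrier_vec n"
  shows "y \<in> cl x \<longleftrightarrow> y \<in> carrier_vec n \<and> cl y = cl x"
proof
  assume "y \<in> cl x"
  then obtain w where w: "w \<in> carrier_vec n" "y = A *\<^sub>v w + x" by (auto simp: cl_def)
  have "y - x = A *\<^sub>v w" unfolding w(2) using w(1) assms by (simp add: add_diff_cancel_vec[where n=n])
  then show "y \<in> carrier_vec n \<and> cl y = cl x" using w assms by (auto simp: cl_iff I_def)
next
  assume y: "y \<in> carrier_vec n \<and> cl y = cl x"
  then show "y \<in> cl x" using cl_self[of y] by simp
qed

lemma carrier_T: "carrier T = cl ` carrier_vec n"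
  by (auto simp: T_def boundary_def Let_def sym coker_def carrier_FactGroup cl_def[abs_def] r_coset_def
      monoid_vec_def intro!: image_cong)

lemma mult_T:
  assumes "x \<in> carrier_vec n" "y \<in> carrier_vec n"
  shows "cl x \<otimes>\<^bsub>T\<^esub> cl y = cl (x + y)"
proof -
  have "cl x \<otimes>\<^bsub>T\<^esub> cl y = {a + b | a b. a \<in> cl x \<and> b \<in> cl y}"
    by (auto simp: T_def boundary_def Let_def coker_def set_mult_def monoid_vec_def FactGroup_def)
  also have "\<dots> = cl (x + y)"
  proof (intro Set.set_eqI iffI)
    fix z assume "z \<in> {a + b | a b. a \<in> cl x \<and> b \<in> cl y}"
    then obtain v w where v: "v \<in> carrier_vec n" "w \<in> carrier_vec n" "z = (A *\<^sub>v v + x) + (A *\<^sub>v w + y)"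
      by (auto simp: cl_def)
    then have "z = A *\<^sub>v (v + w) + (x + y)"
      using assms A by (simp add: A_add) (intro eq_vecI, auto simp del: index_mult_mat_vec)
    then show "z \<in> cl (x + y)" using v by (auto simp: cl_def)
  next
    fix z assume "z \<in> cl (x + y)"
    then obtain v where v: "v \<in> carrier_vec n" "z = A *\<^sub>v v + (x + y)" by (auto simp: cl_def)
    then have "z = (A *\<^sub>v v + x) + y" using assms A by (intro eq_vecI) (auto simp del: index_mult_mat_vec)
    moreover have "y \<in> cl y" using assms by (simp add: mem_cl)
    ultimately show "z \<in> {a + b | a b. a \<in> cl x \<and> b \<in> cl y}" using v by (auto simp: cl_def)
  qed
  finally show ?thesis .
qed

text \<open>For any admissible \<open>y\<close>, \<open>s\<close>, \<open>z\<close>, applying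
  \<open>C\<close> to \<open>s y = A z\<close> gives \<open>s C y = d z\<close>, so the value at
  \<open>z\<close> divided by \<open>s^2\<close> is exactly \<open>norm_form y / (2 d)\<close>.
  Replacing \<open>x\<close> by \<open>y = A w + x\<close> changes \<open>norm_form\<close> by a
  multiple of \<open>2 d\<close>, not merely of \<open>d\<close>, because \<open>A\<close> is even:
  \<open>w \<bullet> A w\<close> is twice the value of \<open>Q\<close> at \<open>w\<close>.\<close>

lemma quad_T:
  assumes x: "x \<in> carrier_vec n"
  shows "lf_quad T (cl x) = QZ_class (of_int (norm_form x) / of_int (2 * d))"
proof -
  have *: "QZ_class (of_int (form_value (form_class n Q) z) / of_int (s^2)) =
      QZ_class (of_int (norm_form x) / of_int (2 * d))"
    if y: "y \<in> cl x" and s: "s \<noteq> 0" and z: "z \<in> carrier_vec n" and e: "s \<cdot>\<^sub>v y = A *\<^sub>v z" for y s z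
  proof -
    obtain w where w: "w \<in> carrier_vec n" "y = A *\<^sub>v w + x" using y by (auto simp: cl_def)
    have yc: "y \<in> carrier_vec n" using w x by simp
    have "s \<cdot>\<^sub>v (C *\<^sub>v y) = C *\<^sub>v (A *\<^sub>v z)" unfolding e[symmetric] using yc by (simp add: C_smult)
    also have "\<dots> = d \<cdot>\<^sub>v z" using z by (rule C_A)
    finally have sd: "s \<cdot>\<^sub>v (C *\<^sub>v y) = d \<cdot>\<^sub>v z" .
    have 1: "s * norm_form y = d * (y \<bullet> z)"
      using arg_cong[OF sd, of "\<lambda>v. y \<bullet> v"] yc z by (simp add: norm_form_def)
    have "z \<bullet> (A *\<^sub>v z) = s * (y \<bullet> z)"
      unfolding e[symmetric] using yc z comm_scalar_prod[of z n y] by simp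
    then have 2: "2 * (z \<bullet> (Q *\<^sub>v z)) = s * (y \<bullet> z)" using form_twice[OF z] by simp
    have "norm_form y = (A *\<^sub>v w + x) \<bullet> (d \<cdot>\<^sub>v w + C *\<^sub>v x)"
      unfolding norm_form_def w(2) using w x by (simp add: C_add C_A)
    also have "\<dots> = d * ((A *\<^sub>v w) \<bullet> w) + (A *\<^sub>v w) \<bullet> (C *\<^sub>v x) + d * (x \<bullet> w) + norm_form x"
      using w x by (simp add: scalar_prod_add_distrib[where n=n] add_scalar_prod_distrib[where n=n] norm_form_def distrib_left)
    also have "(A *\<^sub>v w) \<bullet> (C *\<^sub>v x) = d * (x \<bullet> w)"
      using w x comm_scalar_prod[of w n x] by (simp add: A_self_adjoint A_C)
    also have "(A *\<^sub>v w) \<bullet> w = 2 * (w \<bullet> (Q *\<^sub>v w))"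
      using w by (simp add: A_self_adjoint form_twice)
    finally have 3: "norm_form y = norm_form x + 2 * d * (w \<bullet> (Q *\<^sub>v w) + x \<bullet> w)"
      by (simp add: algebra_simps)
    have "2 * d * (z \<bullet> (Q *\<^sub>v z)) = s^2 * norm_form y"
      using 1 2 by (metis mult.assoc mult.left_commute power2_eq_square)
    then have "rat_of_int (2 * d * (z \<bullet> (Q *\<^sub>v z))) = of_int (s^2 * (norm_form x + 2 * d * (w \<bullet> (Q *\<^sub>v w) + x \<bullet> w)))"
      using 3 by simp
    then have "rat_of_int (z \<bullet> (Q *\<^sub>v z)) / of_int (s^2) - of_int (norm_form x) / of_int (2 * d)
        = of_int (w \<bullet> (Q *\<^sub>v w) + x \<bullet> w)"
      using s d0 by (simp add: field_simps)
    then show ?thesis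
      by (simp add: QZ_class_eq_iff form_value_form_class[OF Q z] del: of_int_add)
  qed
  have xx: "x \<in> cl x" using x by (simp add: mem_cl)
  have "{QZ_class (of_int (form_value (form_class n Q) z) / of_int (s^2)) | y s z.
       y \<in> cl x \<and> s \<noteq> 0 \<and> z \<in> carrier_vec n \<and> s \<cdot>\<^sub>v y = A *\<^sub>v z}
     = {QZ_class (of_int (norm_form x) / of_int (2 * d))}" (is "?S = {?q}")
  proof
    show "?S \<subseteq> {?q}" using * by blast
    \<comment> \<open>The choice \<open>s = d\<close>, \<open>z = C x\<close> shows that the set of
      values is not empty, so it is a singleton.\<close>
    have "d \<cdot>\<^sub>v x = A *\<^sub>v (C *\<^sub>v x)" "C *\<^sub>v x \<in> carrier_vec n" using x by (simp_all add: A_C)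
    with *[OF xx d0] xx d0 show "{?q} \<subseteq> ?S" by blast
  qed
  then show ?thesis
    by (simp add: T_def boundary_def Let_def boundary_quad_def sym)
qed

text \<open>Surjectivity follows from injectivity because the boundary is finite, and
  \<open>lf_bilin\<close> is preserved because it is the polarisation of \<open>lf_quad\<close>. The
  criterion serves both for maps induced by isometries and for the reflection-like map, which comes
  from no isometry.\<close>

lemma class_map_in_Aut:
  assumes closed_m: "\<And>x. x \<in> carrier_vec n \<Longrightarrow> m x \<in> carrier_vec n"
    and add_m: "\<And>x y. x \<in> carrier_vec n \<Longrightarrow> y \<in> carrier_vec n \<Longrightarrow> m (x + y) = m x + m y"
    and inj_m: "\<And>x. x \<in> carrier_vec n \<Longrightarrow> m x \<in> I \<Longrightarrow> x \<in> I"
    and norm_m: "\<And>x. x \<in> carrier_vec n \<Longrightarrow> 2 * d dvd norm_form (m x) - norm_form x"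
    and ext: "F \<in> extensional (carrier T)"
    and F: "\<And>x. x \<in> carrier_vec n \<Longrightarrow> F (cl x) = cl (m x)"
  shows "F \<in> carrier (Aut_linking T)"
proof -
  have minus_m: "m (x - y) = m x - m y" if "x \<in> carrier_vec n" "y \<in> carrier_vec n" for x y
  proof -
    have "x = (x - y) + y" using that by (intro eq_vecI) auto
    then have "m x = m (x - y) + m y" using add_m[of "x - y" y] that by simp
    then show ?thesis using closed_m[of x] closed_m[of y] closed_m[of "x - y"] that by (intro eq_vecI) auto
  qed
  have Fc: "F X \<in> carrier T" if "X \<in> carrier T" for X
    using that by (auto simp: carrier_T F closed_m)
  have hom: "F \<in> hom T T"
  proof (rule homI)
    fix X Y assume "X \<in> carrier T" "Y \<in> carrier T"
    then obtain x y where "x \<in> carrier_vec n" "X = cl x" "y \<in> carrier_vec n" "Y = cl y"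
      by (auto simp: carrier_T)
    then show "F (X \<otimes>\<^bsub>T\<^esub> Y) = F X \<otimes>\<^bsub>T\<^esub> F Y" by (simp add: mult_T F add_m closed_m)
  qed (rule Fc)
  have "inj_on F (carrier T)"
  proof (rule inj_onI)
    fix X Y assume "X \<in> carrier T" "Y \<in> carrier T" "F X = F Y"
    then obtain x y where xy: "x \<in> carrier_vec n" "X = cl x" "y \<in> carrier_vec n" "Y = cl y"
      "cl (m x) = cl (m y)" by (auto simp: carrier_T F)
    then have "m (x - y) \<in> I" by (simp add: cl_iff closed_m minus_m)
    then show "X = Y" using xy inj_m[of "x - y"] by (simp add: cl_iff)
  qed
  moreover from this have "F ` carrier T = carrier T"
    using Fc T.finite_carrier by (intro endo_inj_surj) auto
  ultimately have iso: "F \<in> iso T T" using hom by (simp add: iso_def bij_betw_def)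
  have quad: "lf_quad T (F X) = lf_quad T X" if "X \<in> carrier T" for X
  proof -
    obtain x where x: "x \<in> carrier_vec n" "X = cl x" using \<open>X \<in> carrier T\<close> by (auto simp: carrier_T)
    obtain k where k: "norm_form (m x) = norm_form x + 2 * d * k"
      using norm_m[OF x(1)] by (auto simp: dvd_def algebra_simps)
    have "rat_of_int (norm_form (m x)) / of_int (2 * d) - of_int (norm_form x) / of_int (2 * d) = of_int k"
      unfolding k using d0 by (simp add: field_simps)
    then show ?thesis using x by (simp add: F quad_T closed_m QZ_class_eq_iff)
  qed
  \<comment> \<open>The polarisation identity \<open>quad_add\<close> expresses both sides through
    \<open>lf_quad\<close>.\<close>
  have "lf_bilin T (F X) (F Y) = lf_bilin T X Y" if "X \<in> carrier T" "Y \<in> carrier T" for X Y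
    using T.quad_add[OF that] T.quad_add[OF Fc[OF that(1)] Fc[OF that(2)]] quad that
      hom_mult[OF hom that] T.m_closed by (metis (no_types, lifting))
  then show ?thesis
    using iso quad ext by (simp add: Aut_linking_def linking_isometry_def)
qed

section \<open>Automorphisms of the boundary induced by isometries\<close>

lemma isometry_inverse:
  assumes "G \<in> carrier (Aut_form n (form_class n Q))"
  obtains H where "G \<in> carrier_mat n n" "H \<in> carrier_mat n n" "G * H = 1\<^sub>m n" "H * G = 1\<^sub>m n"
    "inv\<^bsub>ring_mat TYPE(int) n ()\<^esub> (G\<^sup>T) = H\<^sup>T" "G\<^sup>T * A * G = A"
proof -
  interpret R: ring "ring_mat TYPE(int) n ()" by (rule ring_mat)
  have iso: "form_isometry n (form_class n Q) (form_class n Q) G"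
    using assms by (simp add: Aut_form_def)
  then obtain H where H: "G \<in> carrier_mat n n" "H \<in> carrier_mat n n" "G * H = 1\<^sub>m n" "H * G = 1\<^sub>m n"
    by (auto simp: form_isometry_def Units_def ring_mat_simps)
  have t: "H\<^sup>T * G\<^sup>T = 1\<^sub>m n" "G\<^sup>T * H\<^sup>T = 1\<^sub>m n"
    unfolding transpose_mult[OF H(1,2), symmetric] transpose_mult[OF H(2,1), symmetric] H(3,4) by simp_all
  have "inv\<^bsub>ring_mat TYPE(int) n ()\<^esub> (G\<^sup>T) = H\<^sup>T"
    by (rule R.inv_char) (use H t in \<open>simp_all add: ring_mat_simps\<close>)
  moreover have "G\<^sup>T * A * G = A"
    using form_isometry_symmetrisation[OF H(1) Q iso] by (simp add: A_def)
  ultimately show thesis using that H by blast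
qed

text \<open>The second claim provides the invariant: the induced map lifts to a matrix
  \<open>K\<close>, the inverse transpose of \<open>G\<close>, that preserves
  \<open>norm_form\<close> exactly and not only modulo \<open>2 d\<close>. Indeed
  \<open>C K x = G C x\<close>, and \<open>G\<close> cancels against its inverse in the scalar
  product.\<close>

lemma boundary_aut_properties:
  assumes "G \<in> carrier (Aut_form n (form_class n Q))"
  shows "boundary_aut n (form_class n Q) G \<in> carrier (Aut_linking T)"
    and "\<exists>K\<in>carrier_mat n n. (\<forall>x\<in>carrier_vec n. norm_form (K *\<^sub>v x) = norm_form x) \<and>
      (\<forall>X\<in>carrier T. boundary_aut n (form_class n Q) G X = (\<lambda>x. K *\<^sub>v x) ` X)"
proof -
  obtain H where G: "G \<in> carrier_mat n n" and H: "H \<in> carrier_mat n n"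
    and GH: "G * H = 1\<^sub>m n" and HG: "H * G = 1\<^sub>m n"
    and inv: "inv\<^bsub>ring_mat TYPE(int) n ()\<^esub> (G\<^sup>T) = H\<^sup>T" and GAG: "G\<^sup>T * A * G = A"
    using assms by (rule isometry_inverse)
  have GT: "G\<^sup>T \<in> carrier_mat n n" and HT: "H\<^sup>T \<in> carrier_mat n n" using G H by auto
  have GTHT: "G\<^sup>T * H\<^sup>T = 1\<^sub>m n" and HTGT: "H\<^sup>T * G\<^sup>T = 1\<^sub>m n"
    unfolding transpose_mult[OF G H, symmetric] transpose_mult[OF H G, symmetric] GH HG by simp_all
  define k where "k x = H\<^sup>T *\<^sub>v x" for x
  have kc: "k x \<in> carrier_vec n" if "x \<in> carrier_vec n" for x using HT that by (simp add: k_def)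
  have Gc: "G *\<^sub>v x \<in> carrier_vec n" "H *\<^sub>v x \<in> carrier_vec n" "G\<^sup>T *\<^sub>v x \<in> carrier_vec n"
    if "x \<in> carrier_vec n" for x using G H GT that by simp_all
  have GHx: "G *\<^sub>v (H *\<^sub>v x) = x" "H *\<^sub>v (G *\<^sub>v x) = x" "G\<^sup>T *\<^sub>v k x = x" if "x \<in> carrier_vec n" for x
    using assoc_mult_mat_vec[OF G H that] assoc_mult_mat_vec[OF H G that]
      assoc_mult_mat_vec[OF GT HT that] GH HG GTHT that by (simp_all add: k_def)
  \<comment> \<open>The inverse transpose maps the image of \<open>A\<close> to itself, acting on
    the preimages by \<open>G\<close>.\<close>
  have HTA: "H\<^sup>T * A = A * G"
  proof -
    have "H\<^sup>T * A = H\<^sup>T * (G\<^sup>T * (A * G))" using GAG G GT A by (simp add: assoc_mult_mat[where n\<^sub>1=n and n\<^sub>2=n and n\<^sub>3=n and n\<^sub>4=n])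
    also have "\<dots> = (H\<^sup>T * G\<^sup>T) * (A * G)"
      using G GT HT A by (simp add: assoc_mult_mat[where n\<^sub>1=n and n\<^sub>2=n and n\<^sub>3=n and n\<^sub>4=n])
    also have "\<dots> = A * G" using HTGT A G by (simp add: left_mult_one_mat[where nr=n and nc=n])
    finally show ?thesis .
  qed
  have kA: "k (A *\<^sub>v w) = A *\<^sub>v (G *\<^sub>v w)" if "w \<in> carrier_vec n" for w
    unfolding k_def using assoc_mult_mat_vec[OF HT A that] assoc_mult_mat_vec[OF A G that] HTA by simp
  have k_add: "k (x + y) = k x + k y" if "x \<in> carrier_vec n" "y \<in> carrier_vec n" for x y
    unfolding k_def using mult_add_distrib_mat_vec[OF HT that] .
  have k_smult: "k (r \<cdot>\<^sub>v x) = r \<cdot>\<^sub>v k x" if "x \<in> carrier_vec n" for r x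
    unfolding k_def by (rule mult_mat_smult_vec[OF HT that])
  \<comment> \<open>Both sides are compared after applying the injective \<open>A\<close>, where
    each becomes \<open>d\<close> times \<open>k x\<close>.\<close>
  have Ck: "C *\<^sub>v k x = G *\<^sub>v (C *\<^sub>v x)" if x: "x \<in> carrier_vec n" for x
  proof (rule A_cancel)
    have "A *\<^sub>v (G *\<^sub>v (C *\<^sub>v x)) = k (d \<cdot>\<^sub>v x)" using x by (simp add: kA[symmetric] A_C)
    also have "\<dots> = A *\<^sub>v (C *\<^sub>v k x)" using x by (simp add: k_smult A_C kc)
    finally show "A *\<^sub>v (C *\<^sub>v k x) = A *\<^sub>v (G *\<^sub>v (C *\<^sub>v x))" by simp
  qed (use x kc Gc in auto)
  have k_norm: "norm_form (k x) = norm_form x" if x: "x \<in> carrier_vec n" for x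
  proof -
    have "norm_form (k x) = (H\<^sup>T *\<^sub>v x) \<bullet> (G *\<^sub>v (C *\<^sub>v x))"
      unfolding norm_form_def Ck[OF x] by (simp add: k_def)
    also have "\<dots> = x \<bullet> (H *\<^sub>v (G *\<^sub>v (C *\<^sub>v x)))"
      using transpose_vec_mult_scalar[OF H, of "G *\<^sub>v (C *\<^sub>v x)" x] x Gc by simp
    finally show ?thesis using x GHx by (simp add: norm_form_def)
  qed
  have image: "k ` cl x = cl (k x)" if x: "x \<in> carrier_vec n" for x
  proof (intro Set.set_eqI iffI)
    fix z assume "z \<in> k ` cl x"
    then obtain w where w: "w \<in> carrier_vec n" "z = k (A *\<^sub>v w + x)" by (auto simp: cl_def)
    then have "z = A *\<^sub>v (G *\<^sub>v w) + k x" using x by (simp add: k_add kA)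
    then show "z \<in> cl (k x)" using w Gc by (auto simp: cl_def)
  next
    fix z assume "z \<in> cl (k x)"
    then obtain w where w: "w \<in> carrier_vec n" "z = A *\<^sub>v w + k x" by (auto simp: cl_def)
    then have "z = k (A *\<^sub>v (H *\<^sub>v w) + x)" using x Gc GHx by (simp add: k_add kA)
    moreover have "A *\<^sub>v (H *\<^sub>v w) + x \<in> cl x" using w Gc by (auto simp: cl_def)
    ultimately show "z \<in> k ` cl x" by blast
  qed
  have ba: "boundary_aut n (form_class n Q) G = (\<lambda>X\<in>carrier T. k ` X)"
    by (simp add: boundary_aut_def inv T_def k_def[abs_def])
  show "boundary_aut n (form_class n Q) G \<in> carrier (Aut_linking T)"
  proof (rule class_map_in_Aut[of k])
    fix x assume x: "x \<in> carrier_vec n" and "k x \<in> I"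
    then obtain w where w: "w \<in> carrier_vec n" "k x = A *\<^sub>v w" by (auto simp: I_def)
    then have "k (A *\<^sub>v (H *\<^sub>v w)) = k x" using Gc by (simp add: kA GHx)
    then have "A *\<^sub>v (H *\<^sub>v w) = x" using x w Gc GHx(3) closed(1) by metis
    then show "x \<in> I" using w Gc by (auto simp: I_def)
  qed (use kc k_add k_norm image in \<open>auto simp: ba carrier_T\<close>)
  show "\<exists>K\<in>carrier_mat n n. (\<forall>x\<in>carrier_vec n. norm_form (K *\<^sub>v x) = norm_form x) \<and>
      (\<forall>X\<in>carrier T. boundary_aut n (form_class n Q) G X = (\<lambda>x. K *\<^sub>v x) ` X)"
    using HT k_norm by (intro bexI[of _ "H\<^sup>T"]) (auto simp: ba k_def)
qed

text \<open>The identity isometry puts every automorphism into its own orbit, so two orbits differ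
  as soon as a point of one is missing from the other.\<close>

lemma boundary_aut_one:
  "1\<^sub>m n \<in> carrier (Aut_form n (form_class n Q))"
  "boundary_aut n (form_class n Q) (1\<^sub>m n) = \<one>\<^bsub>Aut_linking T\<^esub>"
proof -
  interpret R: ring "ring_mat TYPE(int) n ()" by (rule ring_mat)
  have "1\<^sub>m n \<in> Units (ring_mat TYPE(int) n ())"
    using R.Units_one_closed by (simp add: ring_mat_simps)
  moreover have "(1\<^sub>m n)\<^sup>T * Q * 1\<^sub>m n = Q" using Q by simp
  ultimately show "1\<^sub>m n \<in> carrier (Aut_form n (form_class n Q))"
    by (simp add: Aut_form_def form_isometry_def pullback_form_class[OF _ Q])
  have "inv\<^bsub>ring_mat TYPE(int) n ()\<^esub> ((1\<^sub>m n)\<^sup>T) = (1\<^sub>m n :: int mat)"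
    using R.inv_one by (simp add: ring_mat_simps)
  moreover have "(\<lambda>x. (1\<^sub>m n :: int mat) *\<^sub>v x) ` X = X" if "X \<in> carrier T" for X
  proof -
    have "X \<subseteq> carrier_vec n" using that by (auto simp: carrier_T mem_cl)
    then have "(\<lambda>x. (1\<^sub>m n :: int mat) *\<^sub>v x) ` X = id ` X" by (intro image_cong) auto
    then show ?thesis by simp
  qed
  ultimately show "boundary_aut n (form_class n Q) (1\<^sub>m n) = \<one>\<^bsub>Aut_linking T\<^esub>"
    unfolding boundary_aut_def T_def[symmetric] Aut_linking_one by (intro restrict_ext) simp
qed

text \<open>If \<open>f\<close> were in the orbit of the identity, then \<open>f = g1 g2^-1\<close>
  with both factors induced by isometries. Choosing \<open>Y\<close> with
  \<open>g2 Y = cl x\<close>, the vector \<open>x\<close> is \<open>K2 y\<close> for some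
  \<open>y\<close> in \<open>Y\<close>, and \<open>K1 y\<close> is a member of
  \<open>f (cl x) = g1 Y\<close> with the same norm as \<open>x\<close>, against the assumption
  \<open>no\<close>.\<close>

lemma bAut_nontrivial:
  assumes f: "f \<in> carrier (Aut_linking T)" and x: "x \<in> carrier_vec n"
    and no: "\<And>y. y \<in> f (cl x) \<Longrightarrow> norm_form y \<noteq> norm_form x"
  shows "\<exists>X \<in> bAut n (form_class n Q). \<exists>Y \<in> bAut n (form_class n Q). X \<noteq> Y"
proof -
  let ?\<psi> = "form_class n Q" and ?L = "Aut_linking T"
  interpret L: group ?L by (rule group_Aut_linking) (rule T.is_group)
  define orb where "orb = orbit (Aut_form n ?\<psi> \<times>\<times> Aut_form n ?\<psi>) (boundary_action n ?\<psi>)"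
  have orb: "orb g = {boundary_aut n ?\<psi> G1 \<otimes>\<^bsub>?L\<^esub> g \<otimes>\<^bsub>?L\<^esub> inv\<^bsub>?L\<^esub> boundary_aut n ?\<psi> G2 | G1 G2.
      G1 \<in> carrier (Aut_form n ?\<psi>) \<and> G2 \<in> carrier (Aut_form n ?\<psi>)}" for g
    by (auto simp: orb_def orbit_def boundary_action_def T_def)
  have bAut: "bAut n ?\<psi> = orb ` carrier ?L"
    by (auto simp: bAut_def orbits_def orb_def T_def)
  have "f = \<one>\<^bsub>?L\<^esub> \<otimes>\<^bsub>?L\<^esub> f \<otimes>\<^bsub>?L\<^esub> inv\<^bsub>?L\<^esub> \<one>\<^bsub>?L\<^esub>" using f by simp
  then have f_orb: "f \<in> orb f"
    unfolding orb using boundary_aut_one by (auto intro!: exI[of _ "1\<^sub>m n"])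
  have "f \<notin> orb \<one>\<^bsub>?L\<^esub>"
  proof
    assume "f \<in> orb \<one>\<^bsub>?L\<^esub>"
    then obtain G1 G2 where G: "G1 \<in> carrier (Aut_form n ?\<psi>)" "G2 \<in> carrier (Aut_form n ?\<psi>)"
      and fe: "f = boundary_aut n ?\<psi> G1 \<otimes>\<^bsub>?L\<^esub> \<one>\<^bsub>?L\<^esub> \<otimes>\<^bsub>?L\<^esub> inv\<^bsub>?L\<^esub> boundary_aut n ?\<psi> G2"
      by (auto simp: orb)
    let ?g1 = "boundary_aut n ?\<psi> G1" and ?g2 = "boundary_aut n ?\<psi> G2"
    have g: "?g1 \<in> carrier ?L" "?g2 \<in> carrier ?L" using G boundary_aut_properties(1) by auto
    then have eq: "f \<otimes>\<^bsub>?L\<^esub> ?g2 = ?g1" unfolding fe by (simp add: L.m_assoc)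
    have X: "cl x \<in> carrier T" using x by (simp add: carrier_T)
    have "?g2 ` carrier T = carrier T"
      using g(2) by (auto simp: Aut_linking_def linking_isometry_def iso_def bij_betw_def)
    then obtain Y where Y: "Y \<in> carrier T" "?g2 Y = cl x" using X by (metis imageE)
    have fY: "f (cl x) = ?g1 Y"
      using fun_cong[OF eq, of Y] Y f g by (simp add: Aut_linking_mult compose_def)
    have xY: "x \<in> ?g2 Y" using Y(2) x by (simp add: mem_cl)
    obtain K2 where K2: "K2 \<in> carrier_mat n n" "\<forall>x\<in>carrier_vec n. norm_form (K2 *\<^sub>v x) = norm_form x"
      "\<forall>X\<in>carrier T. ?g2 X = (\<lambda>x. K2 *\<^sub>v x) ` X" using boundary_aut_properties(2)[OF G(2)] by blast
    have "x \<in> (\<lambda>x. K2 *\<^sub>v x) ` Y" using xY K2(3) Y(1) by simp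
    then obtain y where y: "y \<in> Y" "x = K2 *\<^sub>v y" by blast
    have yc: "y \<in> carrier_vec n" using y Y by (auto simp: carrier_T mem_cl)
    obtain K1 where K1: "K1 \<in> carrier_mat n n" "\<forall>x\<in>carrier_vec n. norm_form (K1 *\<^sub>v x) = norm_form x"
      "\<forall>X\<in>carrier T. ?g1 X = (\<lambda>x. K1 *\<^sub>v x) ` X" using boundary_aut_properties(2)[OF G(1)] by blast
    have "K1 *\<^sub>v y \<in> f (cl x)" using fY K1 Y y by simp
    moreover have "norm_form (K1 *\<^sub>v y) = norm_form x" using K1 K2 y yc by simp
    ultimately show False using no by blast
  qed
  then show ?thesis using f f_orb bAut L.one_closed by blast
qed

end

section \<open>The lattice \<open>D\<^sub>h\<close> and its dual in coordinates\<close>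

lemma mat_mult_vec_index:
  assumes "i < n" "v \<in> carrier_vec n"
  shows "(mat n n f *\<^sub>v v) $ i = (\<Sum>j<n. f (i, j) * v $ j)"
  using assms by (simp add: scalar_prod_def lessThan_atLeast0)

text \<open>Twice the Gram matrix of \<open>D\<^sub>h\<close> in the basis
  \<open>2 e\<^sub>0\<close>, \<open>e\<^sub>0 + e\<^sub>i\<close>; the sign \<epsilon> is kept
  outside.\<close>

definition gram_entry :: "nat \<Rightarrow> nat \<Rightarrow> int" where
  "gram_entry i j = (if i = 0 \<and> j = 0 then 8 else if i = 0 \<or> j = 0 \<or> i = j then 4 else 2)"

text \<open>Four times the Gram matrix of the dual basis, whose first vector is half of
  \<open>e\<^sub>0\<close> minus all other \<open>e\<^sub>i\<close>, and whose other vectors are the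
  \<open>e\<^sub>i\<close> with \<open>i > 0\<close>.\<close>

definition dual_gram_entry :: "nat \<Rightarrow> nat \<Rightarrow> nat \<Rightarrow> int" where
  "dual_gram_entry h i j =
     (if i = 0 \<and> j = 0 then int h else if i = 0 \<or> j = 0 then -2 else if i = j then 4 else 0)"

text \<open>The coordinates of \<open>u\<close> in the dual basis and in the basis of \<open>D\<^sub>h\<close>.\<close>

definition refl_vec :: "nat \<Rightarrow> int vec" where
  "refl_vec h = vec h (\<lambda>i. if i < 6 then 2 else 1)"

definition refl_coords :: "nat \<Rightarrow> int vec" where
  "refl_coords h = vec h (\<lambda>i. if i = 0 then -2 else if i < 6 then 1 else 0)"

lemma two_theta_symmetrisation:
  "two_theta_mat h \<epsilon> + (two_theta_mat h \<epsilon>)\<^sup>T = mat h h (\<lambda>(i, j). \<epsilon> * gram_entry i j)"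
  by (rule eq_matI) (auto simp: two_theta_mat_def gram_entry_def)

lemma fixes f :: "nat \<Rightarrow> int"
  shows sum_lessThan_6: "(\<Sum>k<6. f k) = f 0 + f 1 + f 2 + f 3 + f 4 + f 5"
  and sum_lessThan_7: "(\<Sum>k<7. f k) = f 0 + f 1 + f 2 + f 3 + f 4 + f 5 + f 6"
  by (simp_all add: eval_nat_numeral lessThan_Suc algebra_simps)

lemma gram_entry_mult:
  assumes "h \<in> {6, 7}" "i < h" "j < h"
  shows "(\<Sum>k<h. gram_entry i k * dual_gram_entry h k j) = (if i = j then 8 else 0)"
proof -
  have "\<forall>i<6. \<forall>j<6. (\<Sum>k<6. gram_entry i k * dual_gram_entry 6 k j) = (if i = j then 8 else 0)"
    by (simp add: eval_nat_numeral All_less_Suc lessThan_Suc gram_entry_def dual_gram_entry_def)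
  moreover have "\<forall>i<7. \<forall>j<7. (\<Sum>k<7. gram_entry i k * dual_gram_entry 7 k j) = (if i = j then 8 else 0)"
    by (simp add: eval_nat_numeral All_less_Suc lessThan_Suc gram_entry_def dual_gram_entry_def)
  ultimately show ?thesis using assms by blast
qed

text \<open>The Gram matrix takes coordinates in the basis to dual coordinates; the factor 2 is the
  one built into \<open>gram_entry\<close>.\<close>

lemma gram_entry_refl_coords:
  assumes "h \<in> {6, 7}" "i < h"
  shows "(\<Sum>k<h. gram_entry i k * refl_coords h $ k) = 2 * refl_vec h $ i"
proof -
  have "\<forall>i<6. (\<Sum>k<6. gram_entry i k * refl_coords 6 $ k) = 2 * refl_vec 6 $ i"
    by (simp add: eval_nat_numeral All_less_Suc lessThan_Suc gram_entry_def refl_coords_def refl_vec_def)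
  moreover have "\<forall>i<7. (\<Sum>k<7. gram_entry i k * refl_coords 7 $ k) = 2 * refl_vec 7 $ i"
    by (simp add: eval_nat_numeral All_less_Suc lessThan_Suc gram_entry_def refl_coords_def refl_vec_def)
  ultimately show ?thesis using assms by blast
qed

text \<open>Pairing the two coordinate vectors of \<open>u\<close> gives its norm.\<close>

lemma refl_coords_refl_vec: "h \<in> {6, 7} \<Longrightarrow> refl_coords h \<bullet> refl_vec h = 6"
  by (auto simp: scalar_prod_def lessThan_atLeast0[symmetric] sum_lessThan_6 sum_lessThan_7
      refl_coords_def refl_vec_def)

text \<open>The sign is absorbed into \<open>d = 8 * \<epsilon>\<close>, so the same
  \<open>C\<close> serves for both signs. Both matrices are symmetric, hence one product is the
  transpose of the other.\<close>

lemma scaled_inverse_two_theta: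
  assumes "h \<in> {6, 7}" "\<epsilon> \<in> {1, -1}"
  shows "scaled_inverse h (two_theta_mat h \<epsilon>) (mat h h (\<lambda>(i, j). dual_gram_entry h i j)) (8 * \<epsilon>)"
proof
  let ?A = "mat h h (\<lambda>(i, j). \<epsilon> * gram_entry i j)"
  let ?C = "mat h h (\<lambda>(i, j). dual_gram_entry h i j)"
  have AC: "?A * ?C = (8 * \<epsilon>) \<cdot>\<^sub>m 1\<^sub>m h"
  proof (rule eq_matI)
    fix i j assume "i < dim_row ((8 * \<epsilon>) \<cdot>\<^sub>m 1\<^sub>m h)" "j < dim_col ((8 * \<epsilon>) \<cdot>\<^sub>m 1\<^sub>m h)"
    then have ij: "i < h" "j < h" by auto
    then have "(?A * ?C) $$ (i, j) = \<epsilon> * (\<Sum>k<h. gram_entry i k * dual_gram_entry h k j)"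
      by (simp add: scalar_prod_def lessThan_atLeast0 sum_distrib_left mult.assoc)
    then show "(?A * ?C) $$ (i, j) = ((8 * \<epsilon>) \<cdot>\<^sub>m 1\<^sub>m h) $$ (i, j)"
      using ij assms(1) by (simp add: gram_entry_mult)
  qed auto
  have T: "?A\<^sup>T = ?A" "?C\<^sup>T = ?C"
    by (auto intro!: eq_matI simp: gram_entry_def dual_gram_entry_def)
  have "?C * ?A = (?A * ?C)\<^sup>T"
    using transpose_mult[of ?A h h ?C h] T by simp
  also have "\<dots> = (8 * \<epsilon>) \<cdot>\<^sub>m 1\<^sub>m h"
    unfolding AC by (rule eq_matI) auto
  finally show "?C * (two_theta_mat h \<epsilon> + (two_theta_mat h \<epsilon>)\<^sup>T) = (8 * \<epsilon>) \<cdot>\<^sub>m 1\<^sub>m h"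
    by (simp add: two_theta_symmetrisation)
  show "(two_theta_mat h \<epsilon> + (two_theta_mat h \<epsilon>)\<^sup>T) * ?C = (8 * \<epsilon>) \<cdot>\<^sub>m 1\<^sub>m h"
    using AC by (simp add: two_theta_symmetrisation)
qed (use assms in auto)

section \<open>The map modelled on the reflection in \<open>u\<close>, and the norms in an image
  class\<close>

theorem proposition4p1:
  fixes h :: nat and \<epsilon> :: int
  assumes "h \<in> {6, 7}" and "\<epsilon> \<in> {1, -1}"
  shows "\<exists>x \<in> bAut h (two_theta h \<epsilon>). \<exists>y \<in> bAut h (two_theta h \<epsilon>). x \<noteq> y"
proof -
  define C where "C = mat h h (\<lambda>(i, j). dual_gram_entry h i j)"
  define Q where "Q = two_theta_mat h \<epsilon>"
  interpret S: scaled_inverse h Q C "8 * \<epsilon>"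
    unfolding Q_def C_def using assms by (rule scaled_inverse_two_theta)
  define U l where "U = refl_vec h" and "l = refl_coords h"
  have Uc: "U \<in> carrier_vec h" and lc: "l \<in> carrier_vec h"
    by (simp_all add: U_def l_def refl_vec_def refl_coords_def)
  have ee: "\<epsilon> * \<epsilon> = 1" using assms(2) by auto
  have Am: "S.A = mat h h (\<lambda>(i, j). \<epsilon> * gram_entry i j)"
    unfolding S.A_def unfolding Q_def by (rule two_theta_symmetrisation)
  have Al: "S.A *\<^sub>v l = (2 * \<epsilon>) \<cdot>\<^sub>v U"
  proof (rule eq_vecI)
    fix i assume "i < dim_vec ((2 * \<epsilon>) \<cdot>\<^sub>v U)"
    then have i: "i < h" using Uc by simp
    have "(S.A *\<^sub>v l) $ i = \<epsilon> * (\<Sum>k<h. gram_entry i k * l $ k)"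
      unfolding Am using i lc by (simp add: mat_mult_vec_index sum_distrib_left mult.assoc del: index_mult_mat_vec)
    then show "(S.A *\<^sub>v l) $ i = ((2 * \<epsilon>) \<cdot>\<^sub>v U) $ i"
      using i Uc assms(1) gram_entry_refl_coords[of h i] by (simp add: l_def U_def)
  qed (use Uc in \<open>simp add: Am\<close>)
  have lU: "l \<bullet> U = 6" using assms(1) by (simp add: l_def U_def refl_coords_refl_vec)
  have CU: "C *\<^sub>v U = 4 \<cdot>\<^sub>v l"
  proof (rule S.smult_cancel)
    have "(2 * \<epsilon>) \<cdot>\<^sub>v (C *\<^sub>v U) = C *\<^sub>v (S.A *\<^sub>v l)"
      unfolding Al using Uc by (simp add: S.C_smult)
    also have "\<dots> = (2 * \<epsilon>) \<cdot>\<^sub>v (4 \<cdot>\<^sub>v l)" using lc by (simp add: S.C_A smult_smult_assoc mult.commute)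
    finally show "(2 * \<epsilon>) \<cdot>\<^sub>v (C *\<^sub>v U) = (2 * \<epsilon>) \<cdot>\<^sub>v (4 \<cdot>\<^sub>v l)" .
  qed (use assms(2) Uc lc in auto)
  have CT: "C\<^sup>T = C" by (rule eq_matI) (auto simp: C_def dual_gram_entry_def)
  have UC: "U \<bullet> (C *\<^sub>v x) = 4 * (l \<bullet> x)" if x: "x \<in> carrier_vec h" for x
    using transpose_vec_mult_scalar[OF S.C x Uc] CU CT x lc by simp

  \<comment> \<open>Here \<open>l \<bullet> x\<close> is the inner product of the point
    \<open>x\<close> with \<open>u\<close>. The reflection in \<open>u\<close> has coefficient
    \<open>-2/6 = -1/3\<close>, which is 1 modulo 4 in the 2-adic integers; as \<open>u\<close> lies
    in \<open>D\<^sub>h\<close>, the coefficient 1 gives the same map modulo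
    \<open>2 D\<^sub>h\<close>.\<close>
  define m where "m x = x + (l \<bullet> x) \<cdot>\<^sub>v U" for x
  have mc: "m x \<in> carrier_vec h" if "x \<in> carrier_vec h" for x using that Uc by (simp add: m_def)
  have m_add: "m (x + y) = m x + m y" if "x \<in> carrier_vec h" "y \<in> carrier_vec h" for x y
    unfolding m_def using that Uc lc
    by (intro eq_vecI) (auto simp: scalar_prod_add_distrib[where n=h] algebra_simps)
  have lA: "l \<bullet> (S.A *\<^sub>v w) = 2 * \<epsilon> * (U \<bullet> w)" if w: "w \<in> carrier_vec h" for w
    using S.A_self_adjoint[OF lc w] Al Uc w by simp
  \<comment> \<open>Since \<open>A l\<close> is a multiple of \<open>U\<close>, the map
    \<open>m\<close> preserves the image of \<open>A\<close> and so descends to classes.\<close>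
  have mA: "m (S.A *\<^sub>v w) = S.A *\<^sub>v (w + (U \<bullet> w) \<cdot>\<^sub>v l)" if w: "w \<in> carrier_vec h" for w
    using w lc Uc by (simp add: m_def lA S.A_add S.A_smult Al smult_smult_assoc mult.commute)
  have m_cl: "cl' = S.cl (m x)" if "x \<in> carrier_vec h" "y \<in> S.cl x" "cl' = S.cl (m y)" for x y :: "int vec" and cl'
  proof -
    obtain w where w: "w \<in> carrier_vec h" "y = S.A *\<^sub>v w + x" using \<open>y \<in> S.cl x\<close> by (auto simp: S.cl_def)
    have "m y = S.A *\<^sub>v (w + (U \<bullet> w) \<cdot>\<^sub>v l) + m x" using w that by (simp add: m_add mA)
    then have "m y \<in> S.cl (m x)" using w lc by (auto simp: S.cl_def)
    then show ?thesis using that mc by (simp add: S.mem_cl)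
  qed
  \<comment> \<open>By \<open>m_cl\<close> the union runs over copies of one class, so it returns
    that class.\<close>
  define F where "F = (\<lambda>X\<in>carrier S.T. \<Union>x\<in>X. S.cl (m x))"
  have F: "F (S.cl x) = S.cl (m x)" if x: "x \<in> carrier_vec h" for x
  proof -
    have "S.cl (m y) = S.cl (m x)" if "y \<in> S.cl x" for y using m_cl[OF x that] by simp
    moreover have "x \<in> S.cl x" using x by (simp add: S.mem_cl)
    ultimately have "(\<Union>y\<in>S.cl x. S.cl (m y)) = S.cl (m x)" by blast
    then show ?thesis using x by (simp add: F_def S.carrier_T)
  qed
  have F_Aut: "F \<in> carrier (Aut_linking S.T)"
  proof (rule S.class_map_in_Aut[of m])
    fix x :: "int vec" assume x: "x \<in> carrier_vec h"
    show "2 * (8 * \<epsilon>) dvd S.norm_form (m x) - S.norm_form x"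
    proof
      \<comment> \<open>The cross terms contribute 8 and \<open>U \<bullet> C U = 4 * 6\<close>
        contributes 24. The sum 32 is a multiple of \<open>2 d = 16 * \<epsilon>\<close>.\<close>
      have "S.norm_form (m x) = S.norm_form x + 32 * (l \<bullet> x)^2"
        using x Uc lc comm_scalar_prod[OF x lc] comm_scalar_prod[OF Uc lc]
        by (simp add: S.norm_form_def m_def S.C_add S.C_smult CU UC lU scalar_prod_add_distrib[where n=h]
            add_scalar_prod_distrib[where n=h] power2_eq_square algebra_simps)
      then show "S.norm_form (m x) - S.norm_form x = 2 * (8 * \<epsilon>) * (2 * \<epsilon> * (l \<bullet> x)^2)"
        using ee by (simp add: mult.left_commute[of \<epsilon>] mult.assoc[symmetric])
    qed
    assume "m x \<in> S.I"
    then obtain w where w: "w \<in> carrier_vec h" "m x = S.A *\<^sub>v w" by (auto simp: S.I_def)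
    have "7 * (l \<bullet> x) = l \<bullet> m x"
      using x lc Uc by (simp add: m_def scalar_prod_add_distrib[where n=h] lU)
    then have 7: "7 * (l \<bullet> x) = 2 * \<epsilon> * (U \<bullet> w)" using w by (simp add: lA)
    \<comment> \<open>Recovering \<open>x = m x - (l \<bullet> x) U\<close> inside the image of
      \<open>A\<close> calls for \<open>2 * \<epsilon> * r = - (l \<bullet> x)\<close>. The odd
      factor \<open>7 = 1 + l \<bullet> U\<close> makes this solvable:
      \<open>7 (l \<bullet> x)\<close> is \<open>2 * \<epsilon> * (U \<bullet> w)\<close>, and
      subtracting \<open>8 (l \<bullet> x)\<close> leaves the required value.\<close>
    define r where "r = (U \<bullet> w) - 4 * \<epsilon> * (l \<bullet> x)"
    have "2 * \<epsilon> * r = 2 * \<epsilon> * (U \<bullet> w) - 8 * (\<epsilon> * \<epsilon>) * (l \<bullet> x)"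
      by (simp add: r_def algebra_simps)
    then have r: "2 * \<epsilon> * r = - (l \<bullet> x)" using 7 ee by simp
    have "S.A *\<^sub>v (w + r \<cdot>\<^sub>v l) = m x + (2 * \<epsilon> * r) \<cdot>\<^sub>v U"
      using w lc Uc by (simp add: S.A_add S.A_smult Al smult_smult_assoc mult.commute)
    also have "\<dots> = x" unfolding r m_def using x Uc by (intro eq_vecI) auto
    finally show "x \<in> S.I" using w lc by (auto simp: S.I_def intro!: image_eqI[of _ _ "w + r \<cdot>\<^sub>v l"])
  qed (use mc m_add F in \<open>auto simp: F_def\<close>)

  \<comment> \<open>The point of \<open>D\<^sub>h\<^sup>*\<close> with dual coordinates \<open>y\<close> is \<open>(y\<^sub>0, 2 y\<^sub>1 - y\<^sub>0, \<dots>) / 2\<close>,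
    so \<open>norm_form\<close> is four times its norm.\<close>
  have norm: "S.norm_form y = (y $ 0)^2 + (\<Sum>i=1..<h. (2 * y $ i - y $ 0)^2)" if y: "y \<in> carrier_vec h" for y
  proof -
    have "S.norm_form y = (\<Sum>i<h. y $ i * (\<Sum>j<h. dual_gram_entry h i j * y $ j))"
      unfolding S.norm_form_def unfolding C_def using y by (simp add: scalar_prod_def lessThan_atLeast0)
    then show ?thesis using assms(1)
      by (auto simp: sum_lessThan_6 sum_lessThan_7 dual_gram_entry_def eval_nat_numeral
         sum.atLeastLessThan_Suc algebra_simps)
  qed
  \<comment> \<open>In dual coordinates this is the point \<open>e\<^sub>1\<close>, of norm
    1.\<close>
  define e :: "int vec" where "e = unit_vec h 1"
  have e: "e \<in> carrier_vec h" by (simp add: e_def)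
  have norm_e: "S.norm_form e = 4"
    unfolding norm[OF e] unfolding e_def using assms(1)
    by (auto simp: eval_nat_numeral sum.atLeastLessThan_Suc)
  have "S.norm_form y \<noteq> S.norm_form e" if "y \<in> F (S.cl e)" for y
  proof -
    have le: "l \<bullet> e = 1" using assms(1) lc by (auto simp: e_def l_def refl_coords_def)
    have me: "m e = e + U" unfolding m_def le using Uc by (intro eq_vecI) auto
    obtain w where w: "w \<in> carrier_vec h" "y = S.A *\<^sub>v w + (e + U)"
      using \<open>y \<in> F (S.cl e)\<close> unfolding F[OF e] me by (auto simp: S.cl_def)
    have yc: "y \<in> carrier_vec h" using w e Uc by simp
    have Aw: "(S.A *\<^sub>v w) $ i = (\<Sum>k<h. \<epsilon> * gram_entry i k * w $ k)" if "i < h" for i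
      unfolding Am using that w by (simp add: mat_mult_vec_index del: index_mult_mat_vec)
    \<comment> \<open>Coordinates 0 and 2 of the point \<open>y\<close> are halves of the two
      numbers in \<open>y02\<close>, hence odd. Two odd coordinates already force norm at least 2,
      that is \<open>norm_form\<close> at least 8.\<close>
    have "4 dvd (S.A *\<^sub>v w) $ 0" "2 dvd (S.A *\<^sub>v w) $ 2"
      using assms(1) by (auto simp: Aw gram_entry_def intro!: dvd_sum)
    then obtain a b where ab: "(S.A *\<^sub>v w) $ 0 = 4 * a" "(S.A *\<^sub>v w) $ 2 = 2 * b" by (auto elim!: dvdE)
    have y02: "y $ 0 = 4 * a + 2" "2 * y $ 2 - y $ 0 = 4 * (b - a) + 2"
      using assms(1) ab w e Uc unfolding w(2) by (auto simp: e_def U_def refl_vec_def simp del: index_mult_mat_vec)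
    have sq: "(4 * k + 2)^2 \<ge> 4" for k :: int
    proof -
      have "k * (k + 1) \<ge> 0" by (cases "k \<ge> 0") (auto simp: mult_nonpos_nonpos)
      then show ?thesis by (simp add: power2_eq_square algebra_simps)
    qed
    have "(2 * y $ 2 - y $ 0)^2 \<le> (\<Sum>i=1..<h. (2 * y $ i - y $ 0)^2)"
      using assms(1) by (intro member_le_sum[of 2 "{1..<h}" "\<lambda>i. (2 * y $ i - y $ 0)^2"]) auto
    then have "S.norm_form y \<ge> 8"
      using sq[of a] sq[of "b - a"] unfolding norm[OF yc] y02[symmetric] by linarith
    then show ?thesis by (simp add: norm_e)
  qed
  then show ?thesis
    using S.bAut_nontrivial[OF F_Aut e] by (simp add: two_theta_def Q_def)
qed

end
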